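(* Let $\Gamma=\{1324,123\}$. Define polynomials $U_{\Gamma,n}(y)$ by $U_{\Gamma,0}(y)=1$, $U_{\Gamma,j}(y)=0$ for $j<0$, $U_{\Gamma,1}(y)=-y$, and for $n\ge 2$ $$U_{\Gamma,n}(y)=-yU_{\Gamma,n-1}(y)-yU_{\Gamma,n-2}(y)+\sum_{k=2}^{\lfloor n/2\rfloor}(-y)^kC_{k-1}U_{\Gamma,n-2k}(y),$$ where $C_m=\frac{1}{m+1}\binom{2m}{m}$ is the $m$-th Catalan number. Let $U_\Gamma(t,y)=1+\sum_{n\ge1}U_{\Gamma,n}(y)\frac{t^n}{n!}$. Then $$\mathrm{NM}_\Gamma(t,x,y)=\left(\frac{1}{U_\Gamma(t,y)}\right)^x.$$
   Context: For $\sigma=\sigma_1\cdots\sigma_n$ in the symmetric group $\mathfrak S_n$, $i$ is a descent if $\sigma_i>\sigma_{i+1}$, and $\mathrm{des}(\sigma)$ is the number of descents; $\sigma_j$ is a left-to-right minimum if $\sigma_j<\sigma_i$ for all $i<j$, and $\mathrm{LRmin}(\sigma)$ is the number of left-to-right minima. For a sequence $\alpha=\alpha_1\cdots\alpha_m$ of distinct integers, $\mathrm{red}(\alpha)\in\mathfrak S_m$ is obtained by replacing the $i$-th smallest entry by $i$. For a set $\Gamma$ of permutations, $\sigma$ has a $\Gamma$-match starting at position $i$ if there is $j\ge1$ with $\mathrm{red}(\sigma_i\sigma_{i+1}\cdots\sigma_{i+j})\in\Gamma$; $\mathcal{NM}_n(\Gamma)$ is the set of $\sigma\in\mathfrak S_n$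 with no $\Gamma$-match. Define $\mathrm{NM}_\Gamma(t,x,y)=1+\sum_{n\ge1}\frac{t^n}{n!}\sum_{\sigma\in\mathcal{NM}_n(\Gamma)}x^{\mathrm{LRmin}(\sigma)}y^{1+\mathrm{des}(\sigma)}$ (the $n=0$ term is $1$). *)

theory Defs
  imports
    "HOL-Combinatorics.Multiset_Permutations"
    "HOL-Computational_Algebra.Formal_Power_Series"
    "HOL-Computational_Algebra.Polynomial"
begin

text \<open>
  A permutation of \<open>{1..n}\<close> is the list of its values (one-line notation), so \<open>\<SS>\<^sub>n\<close> is
  \<open>permutations_of_set {1..n}\<close>. List positions count from 0.
\<close>

definition des :: "nat list \<Rightarrow> nat" where
  "des \<sigma> = card {i. Suc i < length \<sigma> \<and> \<sigma> ! i > \<sigma> ! Suc i}"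

definition LRmin :: "nat list \<Rightarrow> nat" where
  "LRmin \<sigma> = card {j. j < length \<sigma> \<and> (\<forall>i<j. \<sigma> ! j < \<sigma> ! i)}"

text \<open>For distinct entries, the i-th smallest entry is the one with exactly i entries at most it.\<close>

definition red :: "nat list \<Rightarrow> nat list" where
  "red \<alpha> = map (\<lambda>a. card {b \<in> set \<alpha>. b \<le> a}) \<alpha>"

text \<open>The factor of length \<open>j + 1\<close> at position \<open>i\<close> must lie entirely inside \<open>\<sigma>\<close>.\<close>

definition match_at :: "nat list set \<Rightarrow> nat list \<Rightarrow> nat \<Rightarrow> bool" where
  "match_at \<Gamma> \<sigma> i \<longleftrightarrow>
     (\<exists>j\<ge>1. i + j < length \<sigma> \<and> red (take (j + 1) (drop i \<sigma>)) \<in> \<Gamma>)"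

definition NM_set :: "nat list set \<Rightarrow> nat \<Rightarrow> nat list set" where
  "NM_set \<Gamma> n = {\<sigma> \<in> permutations_of_set {1..n}. \<nexists>i. match_at \<Gamma> \<sigma> i}"

text \<open>Generating functions are formal power series in \<open>t\<close>.\<close>

definition NM :: "nat list set \<Rightarrow> 'a::field_char_0 \<Rightarrow> 'a \<Rightarrow> 'a fps" where
  "NM \<Gamma> x y = Abs_fps (\<lambda>n. if n = 0 then 1
     else (\<Sum>\<sigma>\<in>NM_set \<Gamma> n. x ^ LRmin \<sigma> * y ^ (1 + des \<sigma>)) / fact n)"

definition Gamma_1324_123 :: "nat list set" where
  "Gamma_1324_123 = {[1, 3, 2, 4], [1, 2, 3]}"

definition catalan :: "nat \<Rightarrow> 'a::field_char_0" where
  "catalan m = 1 / of_nat (m + 1) * of_nat ((2 * m) choose m)"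

text \<open>
  The polynomials in the variable \<open>y = [:0, 1:]\<close>. All indices on the right-hand side are
  nonnegative (\<open>2 * k \<le> n\<close>), so the convention that the polynomials with negative index vanish
  is never used and the truncated subtraction is exact.
\<close>

fun U_poly :: "nat \<Rightarrow> 'a::field_char_0 poly" where
  "U_poly n =
     (if n = 0 then 1
      else if n = 1 then - [:0, 1:]
      else - [:0, 1:] * U_poly (n - 1) - [:0, 1:] * U_poly (n - 2)
        + (\<Sum>k = 2..n div 2. (- [:0, 1:]) ^ k * [:catalan (k - 1):] * U_poly (n - 2 * k)))"

declare U_poly.simps [simp del]

definition U_fps :: "'a::field_char_0 \<Rightarrow> 'a fps" where
  "U_fps y = Abs_fps (\<lambda>n. if n = 0 then 1 else poly (U_poly n) y / fact n)"

text \<open>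
  The power \<open>F\<^sup>x\<close> of a series \<open>F\<close> with constant term 1, for an arbitrary scalar exponent:
  the binomial series \<open>\<Sum>n. (x gchoose n) * (F - 1) ^ n\<close>.
\<close>

definition fps_scalar_power :: "'a::field_char_0 fps \<Rightarrow> 'a \<Rightarrow> 'a fps" where
  "fps_scalar_power F x = fps_binomial x oo (F - 1)"

lemma fps_scalar_power_of_nat:
  fixes F :: "'a::field_char_0 fps"
  assumes "fps_nth F 0 = 1"
  shows "fps_scalar_power F (of_nat n) = F ^ n"
proof -
  have "fps_nth (F - 1) 0 = 0" using assms by simp
  from fps_compose_power[OF this, of "1 + fps_X" n] show ?thesis
    using assms by (simp add: fps_scalar_power_def fps_binomial_of_nat fps_compose_add_distrib)
qed

lemma fps_scalar_power_add:
  fixes F :: "'a::field_char_0 fps"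
  assumes "fps_nth F 0 = 1"
  shows "fps_scalar_power F (a + b) = fps_scalar_power F a * fps_scalar_power F b"
  using assms
  by (simp add: fps_scalar_power_def fps_binomial_add_mult fps_compose_mult_distrib)

lemma fps_scalar_power_exp_ln:
  fixes F :: "'a::field_char_0 fps"
  assumes "fps_nth F 0 = 1"
  shows "fps_scalar_power F x = fps_exp x oo (fps_ln 1 oo (F - 1))"
proof -
  let ?L = "fps_ln 1 :: 'a fps"
  let ?E = "fps_exp x oo ?L"
  have L0: "fps_nth ?L 0 = 0" by (simp add: fps_ln_def)
  have "fps_deriv ?E = (fps_deriv (fps_exp x) oo ?L) * fps_deriv ?L"
    by (rule fps_compose_deriv[OF L0])
  also have "\<dots> = (fps_const x * ?E) * inverse (1 + fps_X)"
    using L0 by (simp add: fps_ln_deriv fps_compose_mult_distrib)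
  finally have "fps_deriv ?E = fps_const x * ?E / (1 + fps_X)"
    by (simp add: fps_divide_unit)
  moreover have "fps_nth ?E 0 = 1" by simp
  ultimately have E: "?E = fps_binomial x"
    using fps_binomial_ODE_unique'[of ?E x] by blast
  have "fps_nth (F - 1) 0 = 0" using assms by simp
  from fps_compose_assoc[OF this L0, of "fps_exp x"] show ?thesis
    by (simp add: fps_scalar_power_def E)
qed

end

theory Submission
  imports Defs
begin

text \<open>
  Both patterns start with their minimum, so cutting a permutation in front of its entry 1 gives
  \<open>F' = x F B\<close> for \<open>F = NM(t,x,y)\<close>, with \<open>B\<close> independent of \<open>x\<close>. Hence \<open>NM(t,x,y) = NM(t,1,y)\<^sup>x\<close>, and
  it remains to show \<open>U * NM(t,1,y) = 1\<close>.

  A permutation avoids 123 iff its ascending runs have length 1 or 2. Cut words into blocks, each a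
  single letter or an ascent, weighted by \<open>y\<close>, and call adjacent blocks \<open>p\<close>, \<open>q\<close> linked if
  \<open>last p < hd q\<close> or \<open>p q\<close> has the pattern 1324. Words in \<open>NM\<close> are exactly the ones with a (unique)
  cutting without links; by inclusion-exclusion the inverse of their exponential generating
  function is the one of the cuttings in which all adjacent blocks are linked, weighted by \<open>-y\<close>.
  Such a cluster splits into maximal chains of 1324-links, each chain lying entirely below the
  next one. A chain is a single letter, or \<open>a\<^sub>1 c\<^sub>1 \<dots> a\<^sub>k c\<^sub>k\<close> with increasing \<open>a\<close>s and \<open>c\<close>s and
  \<open>a\<^sub>i\<^sub>+\<^sub>1 < c\<^sub>i\<close>; the ballot theorem counts \<open>C\<^sub>k\<^sub>-\<^sub>1\<close> of the latter. Splitting off the first chain gives the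
  recurrence for \<open>U\<close>.
\<close>

subsection \<open>Differential equation of scalar powers\<close>

unbundle fps_syntax

text \<open>Coefficient \<open>n\<close> of \<open>H * D\<close> involves only \<open>D $ 0\<close>
  up to \<open>D $ n\<close>, while that of the derivative is \<open>(n + 1) * D $ (n + 1)\<close>.
  Characteristic 0 allows division by \<open>n + 1\<close>, so the coefficients vanish one after the
  other.\<close>

lemma fps_linear_ODE_zero:
  fixes D H :: "'a::field_char_0 fps"
  assumes "fps_deriv D = H * D" and "D $ 0 = 0"
  shows "D = 0"
proof -
  have "D $ n = 0" for n
  proof (induction n rule: less_induct)
    case (less n)
    show ?case
    proof (cases n)
      case 0
      then show ?thesis using assms by simp
    next
      case (Suc m)
      have "of_nat (Suc m) * D $ Suc m = (H * D) $ m"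
        using arg_cong[OF assms(1), of "\<lambda>f. f $ m"] by simp
      also have "\<dots> = 0"
        using less.IH Suc by (auto simp: fps_mult_nth intro!: sum.neutral)
      finally show ?thesis
        using Suc by (simp del: of_nat_Suc)
    qed
  qed
  then show ?thesis
    by (simp add: fps_eq_iff)
qed

text \<open>Write the power as the exponential of \<open>x * L\<close> with \<open>L\<close> the
  logarithm of \<open>V\<close>; the derivative of \<open>L\<close> is
  \<open>V' / V = B\<close>.\<close>

lemma fps_scalar_power_ODE:
  fixes V B :: "'a::field_char_0 fps"
  assumes "V $ 0 = 1" and "fps_deriv V = V * B"
  shows "fps_deriv (fps_scalar_power V x) = fps_const x * fps_scalar_power V x * B"
proof -
  define L where "L = fps_ln 1 oo (V - 1)"
  have V0: "(V - 1) $ 0 = 0" and L0: "L $ 0 = 0"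
    using assms by (simp_all add: L_def fps_ln_nth)
  have VV: "V * inverse V = 1"
    using assms(1) inverse_mult_eq_1'[of V] by simp
  have "fps_deriv L = (inverse (1 + fps_X) oo (V - 1)) * fps_deriv V"
    by (simp add: L_def fps_compose_deriv[OF V0] fps_ln_deriv)
  also have "inverse (1 + fps_X) oo (V - 1) = inverse V"
    by (subst fps_inverse_compose[OF V0]) (simp_all add: fps_compose_add_distrib fps_X_fps_compose_startby0[OF V0])
  also have "inverse V * fps_deriv V = (V * inverse V) * B"
    by (simp only: assms(2) mult_ac)
  finally have L': "fps_deriv L = B"
    using VV by simp
  have "fps_deriv (fps_exp x oo L) = (fps_const x * fps_exp x oo L) * B"
    by (simp add: fps_compose_deriv[OF L0] L')
  then show ?thesis
    using assms(1) L0 by (simp add: fps_scalar_power_exp_ln L_def[symmetric] fps_compose_mult_distrib)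
qed

text \<open>\<open>F\<close> and the power solve the same linear equation with the same constant
  term, so \<open>fps_linear_ODE_zero\<close> applies to their difference.\<close>

lemma eq_fps_scalar_powerI:
  fixes V B F :: "'a::field_char_0 fps"
  assumes "V $ 0 = 1" and "fps_deriv V = V * B"
    and "F $ 0 = 1" and "fps_deriv F = fps_const x * F * B"
  shows "F = fps_scalar_power V x"
proof -
  have "F - fps_scalar_power V x = 0"
  proof (rule fps_linear_ODE_zero)
    show "fps_deriv (F - fps_scalar_power V x) = (fps_const x * B) * (F - fps_scalar_power V x)"
      using fps_scalar_power_ODE[OF assms(1,2), of x] assms(4) by (simp add: algebra_simps)
    show "(F - fps_scalar_power V x) $ 0 = 0"
      using assms by (simp add: fps_scalar_power_def)
  qed
  then show ?thesis by simp
qed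

subsection \<open>Order invariant functions on words\<close>

text \<open>Such a function sees only the relative order of the letters. Its sum over the
  permutations of a set therefore depends on the size of the set alone, which is what exponential
  generating functions require.\<close>

definition order_invariant :: "(nat list \<Rightarrow> 'b) \<Rightarrow> bool" where
  "order_invariant f \<longleftrightarrow> (\<forall>h w. strict_mono_on (set w) h \<longrightarrow> f (map h w) = f w)"

lemma sum_permutations_of_set_cong_card:
  fixes f :: "nat list \<Rightarrow> 'b::comm_monoid_add"
  assumes f: "order_invariant f" and "finite A" "finite B" "card A = card B"
  shows "sum f (permutations_of_set A) = sum f (permutations_of_set B)"
proof -
  have *: "sum f (permutations_of_set C) = sum f (permutations_of_set {..<card C})" if "finite C" for C
  proof -
    obtain h where h: "bij_betw h {..<card C} C" "strict_mono_on {..<card C} h"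
      using ex_bij_betw_strict_mono_card[OF \<open>finite C\<close>] .
    then have inj: "inj_on h {..<card C}" and im: "h ` {..<card C} = C"
      by (auto simp: bij_betw_def)
    have "sum f (permutations_of_set C) = sum f (map h ` permutations_of_set {..<card C})"
      using permutations_of_set_image_inj[OF inj] im by simp
    also have "\<dots> = (\<Sum>w\<in>permutations_of_set {..<card C}. f (map h w))"
    proof (subst sum.reindex)
      show "inj_on (map h) (permutations_of_set {..<card C})"
        by (rule inj_on_mapI) (simp add: inj)
    qed simp
    also have "\<dots> = sum f (permutations_of_set {..<card C})"
      using f h(2) by (intro sum.cong) (auto simp: order_invariant_def permutations_of_setD)
    finally show ?thesis .
  qed
  show ?thesis
    using assms by (simp add: *[of A] *[of B])
qed

lemma bij_betw_append_permutations:
  assumes "finite A" and "k \<le> card A"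
  shows "bij_betw (\<lambda>(B, \<alpha>, \<beta>). \<alpha> @ \<beta>)
    (SIGMA B:{B. B \<subseteq> A \<and> card B = k}. permutations_of_set B \<times> permutations_of_set (A - B))
    (permutations_of_set A)"
proof (rule bij_betw_byWitness[where f' = "\<lambda>w. (set (take k w), take k w, drop k w)"])
  let ?S = "SIGMA B:{B. B \<subseteq> A \<and> card B = k}. permutations_of_set B \<times> permutations_of_set (A - B)"
  show "\<forall>s\<in>?S. (\<lambda>w. (set (take k w), take k w, drop k w)) ((\<lambda>(B, \<alpha>, \<beta>). \<alpha> @ \<beta>) s) = s"
    by (auto simp: permutations_of_set_def distinct_card)
  show "(\<lambda>(B, \<alpha>, \<beta>). \<alpha> @ \<beta>) ` ?S \<subseteq> permutations_of_set A"
    by (auto simp: permutations_of_set_def)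
  show "(\<lambda>w. (set (take k w), take k w, drop k w)) ` permutations_of_set A \<subseteq> ?S"
  proof (rule image_subsetI)
    fix w assume w: "w \<in> permutations_of_set A"
    have "distinct (take k w @ drop k w)" "set (take k w @ drop k w) = A"
      using w by (simp_all only: append_take_drop_id permutations_of_setD)
    moreover have "card (set (take k w)) = k"
      using w assms by (metis distinct_card distinct_take length_finite_permutations_of_set
          length_take min.absorb2 permutations_of_setD(2))
    ultimately show "(set (take k w), take k w, drop k w) \<in> ?S"
      by (auto simp: permutations_of_set_def simp del: append_take_drop_id)
  qed
qed auto

text \<open>The source of the binomial convolution: the prefix has \<open>n choose k\<close>
  possible letter sets, and by order invariance each of them contributes the same product.\<close>

lemma sum_permutations_of_set_take_drop:
  fixes f g :: "nat list \<Rightarrow> 'b::comm_semiring_1"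
  assumes f: "order_invariant f" and g: "order_invariant g" and A: "finite A" "card A = n" and k: "k \<le> n"
  shows "(\<Sum>w\<in>permutations_of_set A. f (take k w) * g (drop k w)) =
    of_nat (n choose k) * (sum f (permutations_of_set {1..k}) * sum g (permutations_of_set {1..n - k}))"
proof -
  let ?S = "SIGMA B:{B. B \<subseteq> A \<and> card B = k}. permutations_of_set B \<times> permutations_of_set (A - B)"
  let ?c = "sum f (permutations_of_set {1..k}) * sum g (permutations_of_set {1..n - k})"
  have fin: "finite {B. B \<subseteq> A \<and> card B = k}"
    using A by auto
  have "(\<Sum>w\<in>permutations_of_set A. f (take k w) * g (drop k w)) =
    (\<Sum>(B, \<alpha>, \<beta>)\<in>?S. f (take k (\<alpha> @ \<beta>)) * g (drop k (\<alpha> @ \<beta>)))"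
    using sum.reindex_bij_betw[OF bij_betw_append_permutations[of A k],
        of "\<lambda>w. f (take k w) * g (drop k w)"] A k
    by (simp add: case_prod_unfold)
  also have "\<dots> = (\<Sum>(B, \<alpha>, \<beta>)\<in>?S. f \<alpha> * g \<beta>)"
    by (intro sum.cong refl) (auto simp: permutations_of_set_def distinct_card)
  also have "\<dots> = (\<Sum>B | B \<subseteq> A \<and> card B = k.
      \<Sum>(\<alpha>, \<beta>)\<in>permutations_of_set B \<times> permutations_of_set (A - B). f \<alpha> * g \<beta>)"
    using fin by (subst sum.Sigma) (auto simp: case_prod_unfold)
  also have "\<dots> = (\<Sum>B | B \<subseteq> A \<and> card B = k. ?c)"
  proof (rule sum.cong[OF refl])
    fix B assume "B \<in> {B. B \<subseteq> A \<and> card B = k}"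
    then have B: "B \<subseteq> A" "card B = k" "finite B"
      using A finite_subset by auto
    have "(\<Sum>(\<alpha>, \<beta>)\<in>permutations_of_set B \<times> permutations_of_set (A - B). f \<alpha> * g \<beta>) =
      sum f (permutations_of_set B) * sum g (permutations_of_set (A - B))"
      by (simp add: sum_product sum.cartesian_product)
    also have "sum f (permutations_of_set B) = sum f (permutations_of_set {1..k})"
      using B by (intro sum_permutations_of_set_cong_card f) auto
    also have "sum g (permutations_of_set (A - B)) = sum g (permutations_of_set {1..n - k})"
      using A B by (intro sum_permutations_of_set_cong_card g) (auto simp: card_Diff_subset)
    finally show "(\<Sum>(\<alpha>, \<beta>)\<in>permutations_of_set B \<times> permutations_of_set (A - B). f \<alpha> * g \<beta>) = ?c" .
  qed
  also have "\<dots> = of_nat (n choose k) * ?c"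
    using A n_subsets[of A k] by simp
  finally show ?thesis .
qed

subsection \<open>Avoidance, descents and left-to-right minima\<close>

text \<open>Both patterns are tested by direct comparisons instead of \<open>red\<close>. The guard
  \<open>w \<noteq> []\<close> reflects that 1324 needs a fourth letter; \<open>hd []\<close> is
  unspecified.\<close>

fun avoids :: "nat list \<Rightarrow> bool" where
  "avoids (a # b # c # w) \<longleftrightarrow> \<not> (a < b \<and> b < c) \<and>
     (w \<noteq> [] \<longrightarrow> \<not> (a < c \<and> c < b \<and> b < hd w)) \<and> avoids (b # c # w)"
| "avoids w \<longleftrightarrow> True"

text \<open>Replaces the cardinality by a list computation, which simplification can evaluate on
  explicit lists of three or four letters.\<close>

lemma red_eq_map_length_filter:
  "distinct w \<Longrightarrow> red w = map (\<lambda>a. length (filter (\<lambda>b. b \<le> a) w)) w"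
  by (simp add: red_def distinct_length_filter Collect_conj_eq Int_commute)

lemma red_eq_123_iff:
  "distinct [a, b, c] \<Longrightarrow> red [a, b, c] = [1, 2, 3] \<longleftrightarrow> a < b \<and> b < c"
  by (subst red_eq_map_length_filter) (auto split: if_splits)

lemma red_eq_1324_iff:
  "distinct [a, b, c, d] \<Longrightarrow> red [a, b, c, d] = [1, 3, 2, 4] \<longleftrightarrow> a < c \<and> c < b \<and> b < d"
  by (subst red_eq_map_length_filter) (auto split: if_splits)

lemma match_at_0_iff:
  assumes "distinct w"
  shows "match_at Gamma_1324_123 w 0 \<longleftrightarrow>
    (\<exists>a b c v. w = a # b # c # v \<and> (a < b \<and> b < c \<or> v \<noteq> [] \<and> a < c \<and> c < b \<and> b < hd v))"
proof -
  have len: "length (red v) = length v" for v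
    by (simp add: red_def)
  have "match_at Gamma_1324_123 w 0 \<longleftrightarrow>
    (2 < length w \<and> red (take 3 w) = [1, 2, 3]) \<or> (3 < length w \<and> red (take 4 w) = [1, 3, 2, 4])"
    (is "?L \<longleftrightarrow> ?R")
  proof
    assume ?L
    then obtain j where j: "j < length w" "red (take (j + 1) w) \<in> Gamma_1324_123"
      by (auto simp: match_at_def)
    \<comment> \<open>Since \<open>red\<close> preserves length, only \<open>j = 2\<close> and
      \<open>j = 3\<close> can give a match.\<close>
    then have "length (red (take (j + 1) w)) = j + 1"
      by (simp add: len)
    with j have "j = 2 \<and> red (take (j + 1) w) = [1, 2, 3] \<or> j = 3 \<and> red (take (j + 1) w) = [1, 3, 2, 4]"
      by (auto simp: Gamma_1324_123_def)
    with j show ?R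
      by auto
  next
    assume ?R
    then show ?L
      unfolding match_at_def Gamma_1324_123_def
      by (elim disjE; intro exI[of _ "if red (take 3 w) = [1, 2, 3] \<and> 2 < length w then 2 else 3"]) auto
  qed
  also have "\<dots> \<longleftrightarrow>
    (\<exists>a b c v. w = a # b # c # v \<and> (a < b \<and> b < c \<or> v \<noteq> [] \<and> a < c \<and> c < b \<and> b < hd v))"
  proof (cases "\<exists>a b c v. w = a # b # c # v")
    case True
    then obtain a b c v where w: "w = a # b # c # v" by blast
    show ?thesis
    proof (cases v)
      case Nil
      then show ?thesis
        using assms w red_eq_123_iff[of a b c] by (simp add: numeral_eq_Suc)
    next
      case (Cons d v')
      then show ?thesis
        using assms w red_eq_123_iff[of a b c] red_eq_1324_iff[of a b c d]
        by (simp add: eval_nat_numeral)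
    qed
  next
    case False
    then have "length w \<le> 2"
      by (metis Suc_le_length_iff not_less_eq_eq numeral_2_eq_2)
    with False show ?thesis by auto
  qed
  finally show ?thesis .
qed

lemma match_at_Cons_Suc: "match_at \<Gamma> (a # w) (Suc i) \<longleftrightarrow> match_at \<Gamma> w i"
  by (simp add: match_at_def)

lemma avoids_iff_no_match:
  "distinct w \<Longrightarrow> (\<nexists>i. match_at Gamma_1324_123 w i) \<longleftrightarrow> avoids w"
proof (induction w)
  case Nil
  then show ?case by (simp add: match_at_def)
next
  case (Cons a w)
  have "(\<exists>i. match_at Gamma_1324_123 (a # w) i) \<longleftrightarrow>
    match_at Gamma_1324_123 (a # w) 0 \<or> (\<exists>i. match_at Gamma_1324_123 w i)"
    by (metis match_at_Cons_Suc not0_implies_Suc)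
  then have "(\<nexists>i. match_at Gamma_1324_123 (a # w) i) \<longleftrightarrow>
    \<not> match_at Gamma_1324_123 (a # w) 0 \<and> avoids w"
    using Cons by auto
  also have "\<dots> \<longleftrightarrow> avoids (a # w)"
    unfolding match_at_0_iff[OF Cons.prems]
    by (cases "a # w" rule: avoids.cases) auto
  finally show ?case .
qed

text \<open>Both patterns start with their minimum, so no match can start in \<alpha> and extend to
  \<open>m\<close>: every match lies inside \<alpha> or inside \<open>m # \<beta>\<close>.\<close>

lemma avoids_append_min:
  "\<forall>a\<in>set \<alpha>. m < a \<Longrightarrow> avoids (\<alpha> @ m # \<beta>) \<longleftrightarrow> avoids \<alpha> \<and> avoids (m # \<beta>)"
proof (induction \<alpha> rule: avoids.induct)
  case (1 a b c w)
  then show ?case by (cases w) auto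
next
  case ("2_3" a b)
  then show ?case by (cases \<beta>; cases "tl \<beta>") auto
next
  case ("2_2" a)
  then show ?case by (cases \<beta>) auto
qed auto

lemma avoids_map:
  "strict_mono_on (set w) h \<Longrightarrow> avoids (map h w) \<longleftrightarrow> avoids w"
proof (induction w rule: avoids.induct)
  case (1 a b c w)
  have "strict_mono_on (set (b # c # w)) h"
    using "1.prems" by (auto simp: strict_mono_on_def)
  then have "avoids (map h (b # c # w)) \<longleftrightarrow> avoids (b # c # w)"
    by (rule "1.IH")
  moreover have "h x < h z \<longleftrightarrow> x < z" if "x \<in> set (a # b # c # w)" "z \<in> set (a # b # c # w)" for x z
    using "1.prems" that by (simp add: strict_mono_on_less)
  ultimately show ?case
    by (cases w) auto
qed auto

section \<open>Descents and left-to-right minima around the smallest letter\<close>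

lemma des_simps [simp]:
  "des [] = 0" "des [a] = 0" "des (a # b # w) = of_bool (b < a) + des (b # w)"
proof -
  have "{i. Suc i < length (a # b # w) \<and> (a # b # w) ! i > (a # b # w) ! Suc i} =
    {i. i = 0 \<and> b < a} \<union> Suc ` {i. Suc i < length (b # w) \<and> (b # w) ! i > (b # w) ! Suc i}"
    (is "_ = ?Z \<union> Suc ` ?D")
  proof (rule set_eqI)
    show "i \<in> {i. Suc i < length (a # b # w) \<and> (a # b # w) ! i > (a # b # w) ! Suc i} \<longleftrightarrow>
      i \<in> ?Z \<union> Suc ` ?D" for i
      by (cases i) auto
  qed
  moreover have "card (?Z \<union> Suc ` ?D) = card ?Z + card (Suc ` ?D)"
    by (rule card_Un_disjoint) auto
  moreover have "card ?Z = of_bool (b < a)" by auto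
  moreover have "card (Suc ` ?D) = card ?D"
    by (rule card_image) auto
  ultimately show "des (a # b # w) = of_bool (b < a) + des (b # w)"
    by (simp add: des_def)
qed (simp_all add: des_def)

text \<open>The additional descent leads from the last letter of \<alpha> into
  \<open>m\<close>.\<close>

lemma des_append_min:
  "\<forall>a\<in>set \<alpha>. m < a \<Longrightarrow> \<alpha> \<noteq> [] \<Longrightarrow> des (\<alpha> @ m # \<beta>) = Suc (des \<alpha> + des (m # \<beta>))"
proof (induction \<alpha>)
  case (Cons a \<alpha>)
  then show ?case by (cases \<alpha>) auto
qed simp

lemma des_map:
  "strict_mono_on (set w) h \<Longrightarrow> des (map h w) = des w"
  unfolding des_def by (intro arg_cong[where f = card]) (auto simp: strict_mono_on_less)

lemma LRmin_map:
  "strict_mono_on (set w) h \<Longrightarrow> LRmin (map h w) = LRmin w"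
  unfolding LRmin_def by (intro arg_cong[where f = card]) (auto simp: strict_mono_on_less)

text \<open>\<open>m\<close> is a new left-to-right minimum, and no letter behind it can be
  one.\<close>

lemma LRmin_append_min:
  assumes "\<forall>a\<in>set \<alpha>. m < a" "\<forall>b\<in>set \<beta>. m < b"
  shows "LRmin (\<alpha> @ m # \<beta>) = Suc (LRmin \<alpha>)"
proof -
  let ?M = "\<lambda>w. {j. j < length w \<and> (\<forall>i<j. w ! j < (w ! i :: nat))}"
  have "?M (\<alpha> @ m # \<beta>) = insert (length \<alpha>) (?M \<alpha>)"
  proof (intro equalityI subsetI)
    fix j assume j: "j \<in> ?M (\<alpha> @ m # \<beta>)"
    have "\<not> length \<alpha> < j"
    proof
      assume l: "length \<alpha> < j"
      then obtain i where i: "j = length \<alpha> + Suc i"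
        using less_iff_Suc_add by auto
      have "(\<alpha> @ m # \<beta>) ! j < (\<alpha> @ m # \<beta>) ! length \<alpha>"
        using j l by blast
      then have "\<beta> ! i < m" "i < length \<beta>"
        using j i by (auto simp: nth_append)
      then show False
        using assms(2) by (meson less_asym nth_mem)
    qed
    then consider "j = length \<alpha>" | "j < length \<alpha>" by linarith
    then show "j \<in> insert (length \<alpha>) (?M \<alpha>)"
      using j by cases (auto simp: nth_append)
  next
    fix j assume "j \<in> insert (length \<alpha>) (?M \<alpha>)"
    then show "j \<in> ?M (\<alpha> @ m # \<beta>)"
      using assms(1) by (auto simp: nth_append)
  qed
  then show ?thesis
    by (simp add: LRmin_def)
qed

subsection \<open>Cutting words into blocks\<close>

definition block :: "nat list \<Rightarrow> bool" where
  "block b \<longleftrightarrow> (\<exists>a. b = [a]) \<or> (\<exists>a c. a < c \<and> b = [a, c])"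

definition blocklists :: "nat list \<Rightarrow> nat list list set" where
  "blocklists w = {bs. concat bs = w \<and> (\<forall>b\<in>set bs. block b)}"

text \<open>The letters are named in order of size, so \<open>p @ q\<close> reads
  \<open>a c b d\<close>.\<close>

definition link1324 :: "nat list \<Rightarrow> nat list \<Rightarrow> bool" where
  "link1324 p q \<longleftrightarrow> (\<exists>a b c d. p = [a, c] \<and> q = [b, d] \<and> a < b \<and> b < c \<and> c < d)"

definition link :: "nat list \<Rightarrow> nat list \<Rightarrow> bool" where
  "link p q \<longleftrightarrow> last p < hd q \<or> link1324 p q"

definition block_sum :: "(nat list \<Rightarrow> nat list \<Rightarrow> bool) \<Rightarrow> 'a \<Rightarrow> nat list \<Rightarrow> 'a::comm_ring_1" where
  "block_sum P z w = (\<Sum>bs\<in>blocklists w. of_bool (successively P bs) * z ^ length bs)"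

lemma blocklists_Nil [simp]: "blocklists [] = {[]}"
proof -
  have "bs \<in> blocklists [] \<longleftrightarrow> bs = []" for bs
    by (cases bs) (auto simp: blocklists_def block_def)
  then show ?thesis by auto
qed

lemma blocklists_Cons:
  "bs \<in> blocklists (a # w) \<longleftrightarrow> (\<exists>bs'. bs = [a] # bs' \<and> bs' \<in> blocklists w) \<or>
     (\<exists>c v bs'. w = c # v \<and> a < c \<and> bs = [a, c] # bs' \<and> bs' \<in> blocklists v)"
  by (cases bs) (auto simp: blocklists_def block_def)

lemma finite_blocklists [simp]: "finite (blocklists w)"
proof (induction w rule: length_induct)
  case (1 w)
  show ?case
  proof (cases w)
    case Nil
    then show ?thesis by simp
  next
    case (Cons a v)
    have "blocklists w \<subseteq> (#) [a] ` blocklists v \<union> (#) [a, hd v] ` blocklists (tl v)"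
      by (auto simp: Cons blocklists_Cons)
    moreover have "finite (blocklists v)" "finite (blocklists (tl v))"
      using 1 Cons by auto
    ultimately show ?thesis
      by (meson finite_UnI finite_imageI finite_subset)
  qed
qed

text \<open>Cutting a block list after \<open>j\<close> blocks amounts to cutting the word after
  \<open>k\<close> letters and then each part into blocks; \<open>k\<close> is the number of letters
  in the first \<open>j\<close> blocks.\<close>

lemma sum_blocklists_take_drop:
  fixes F :: "nat list list \<Rightarrow> nat list list \<Rightarrow> 'b::comm_monoid_add"
  shows "(\<Sum>bs\<in>blocklists w. \<Sum>j\<le>length bs. F (take j bs) (drop j bs)) =
    (\<Sum>k\<le>length w. \<Sum>ps\<in>blocklists (take k w). \<Sum>qs\<in>blocklists (drop k w). F ps qs)"
proof -
  have "(\<Sum>bs\<in>blocklists w. \<Sum>j\<le>length bs. F (take j bs) (drop j bs)) =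
    (\<Sum>(bs, j)\<in>(SIGMA bs:blocklists w. {..length bs}). F (take j bs) (drop j bs))"
    by (simp add: sum.Sigma)
  also have "\<dots> = (\<Sum>(k, ps, qs)\<in>(SIGMA k:{..length w}. blocklists (take k w) \<times> blocklists (drop k w)). F ps qs)"
  proof (rule sum.reindex_bij_witness[where i = "\<lambda>(k, ps, qs). (ps @ qs, length ps)"
        and j = "\<lambda>(bs, j). (length (concat (take j bs)), take j bs, drop j bs)"], goal_cases)
    case (2 s)
    then obtain bs j where s: "s = (bs, j)" and bs: "bs \<in> blocklists w"
      by auto
    have w: "w = concat (take j bs) @ concat (drop j bs)"
      using bs by (simp add: blocklists_def flip: concat_append)
    define k where "k = length (concat (take j bs))"
    have "k \<le> length w" "take k w = concat (take j bs)" "drop k w = concat (drop j bs)"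
      using w by (simp_all add: k_def)
    then show ?case
      using bs unfolding s prod.case k_def[symmetric]
      by (auto simp: blocklists_def dest: in_set_takeD in_set_dropD)
  qed (auto simp: blocklists_def min_def)
  also have "\<dots> = (\<Sum>k\<le>length w. \<Sum>ps\<in>blocklists (take k w). \<Sum>qs\<in>blocklists (drop k w). F ps qs)"
    by (simp add: sum.cartesian_product sum.Sigma)
  finally show ?thesis .
qed

text \<open>Compare with the list without its first block \<open>b\<close>. If \<open>P b c\<close>,
  the term \<open>j = 0\<close> vanishes and the others are the terms of \<open>c # bs\<close> with
  opposite sign. Otherwise only \<open>j = 0\<close> and \<open>j = 1\<close> can be nonzero, and
  they cancel.\<close>

lemma alternating_sum_successively:
  assumes "bs \<noteq> []"
  shows "(\<Sum>j\<le>length bs. (- 1) ^ j * (of_bool (successively P (take j bs)) *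
     of_bool (successively (\<lambda>p q. \<not> P p q) (drop j bs)))) = (0::'a::comm_ring_1)"
  using assms
proof (induction bs rule: induct_list012)
  case (3 b c bs)
  let ?T = "\<lambda>bs j. (- 1) ^ j * (of_bool (successively P (take j bs)) *
     of_bool (successively (\<lambda>p q. \<not> P p q) (drop j bs))) :: 'a"
  have IH: "(\<Sum>j\<le>length (c # bs). ?T (c # bs) j) = 0"
    using 3 by simp
  have split: "(\<Sum>j\<le>length (b # c # bs). ?T (b # c # bs) j) =
    ?T (b # c # bs) 0 + (\<Sum>j\<le>length (c # bs). ?T (b # c # bs) (Suc j))"
    by (simp only: length_Cons sum.atMost_Suc_shift)
  show ?case
  proof (cases "P b c")
    case True
    have "?T (b # c # bs) (Suc j) = - ?T (c # bs) j" for j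
      using True by (cases j) simp_all
    then show ?thesis
      unfolding split using True IH by (simp add: sum_negf del: sum.atMost_Suc)
  next
    case False
    have "?T (b # c # bs) (Suc j) = (if j = 0 then - ?T (c # bs) 0 else 0)" for j
      using False by (cases j) simp_all
    then show ?thesis
      unfolding split using False by (simp del: sum.atMost_Suc)
  qed
qed simp_all

text \<open>After exchanging the sums, a fixed cutting of the whole word carries a constant power of
  \<open>z\<close> up to sign, and the signs cancel by \<open>alternating_sum_successively\<close>.
  A nonempty word is needed to have at least one block.\<close>

lemma block_sum_convolution:
  assumes "w \<noteq> []"
  shows "(\<Sum>k\<le>length w. block_sum P (- z) (take k w) * block_sum (\<lambda>p q. \<not> P p q) z (drop k w)) = 0"
proof -
  let ?F = "\<lambda>ps qs. of_bool (successively P ps) * (- z) ^ length ps *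
    (of_bool (successively (\<lambda>p q. \<not> P p q) qs) * z ^ length qs)"
  have "(\<Sum>k\<le>length w. block_sum P (- z) (take k w) * block_sum (\<lambda>p q. \<not> P p q) z (drop k w)) =
    (\<Sum>k\<le>length w. \<Sum>ps\<in>blocklists (take k w). \<Sum>qs\<in>blocklists (drop k w). ?F ps qs)"
    by (simp only: block_sum_def sum_product)
  also have "\<dots> = (\<Sum>bs\<in>blocklists w. \<Sum>j\<le>length bs. ?F (take j bs) (drop j bs))"
    by (rule sum_blocklists_take_drop[symmetric])
  also have "\<dots> = 0"
  proof (rule sum.neutral, rule ballI)
    fix bs assume bs: "bs \<in> blocklists w"
    have "?F (take j bs) (drop j bs) = z ^ length bs * ((- 1) ^ j * (of_bool (successively P (take j bs)) *
     of_bool (successively (\<lambda>p q. \<not> P p q) (drop j bs))))" if "j \<le> length bs" for j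
    proof -
      have "(- z) ^ j * z ^ (length bs - j) = (- 1) ^ j * z ^ length bs"
        using that power_add[of z j "length bs - j"] power_mult_distrib[of "-1" z j]
        by (simp add: mult.assoc)
      then show ?thesis
        using that by (simp add: algebra_simps)
    qed
    then have "(\<Sum>j\<le>length bs. ?F (take j bs) (drop j bs)) = z ^ length bs *
      (\<Sum>j\<le>length bs. (- 1) ^ j * (of_bool (successively P (take j bs)) *
     of_bool (successively (\<lambda>p q. \<not> P p q) (drop j bs))))"
      by (simp add: sum_distrib_left)
    also have "\<dots> = 0"
      using bs assms by (subst alternating_sum_successively) (auto simp: blocklists_def)
    finally show "(\<Sum>j\<le>length bs. ?F (take j bs) (drop j bs)) = 0" .
  qed
  finally show ?thesis .
qed

section \<open>Block sums depend only on the relative order\<close>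

lemma map_blocklists:
  assumes "strict_mono_on (set w) h" "bs \<in> blocklists w"
  shows "map (map h) bs \<in> blocklists (map h w)"
proof -
  have "block (map h b)" if b: "b \<in> set bs" for b
  proof -
    have "block b" "set b \<subseteq> set w"
      using b assms by (auto simp: blocklists_def)
    then show ?thesis
      using assms(1) by (auto simp: block_def strict_mono_on_def)
  qed
  then show ?thesis
    using assms by (auto simp: blocklists_def map_concat)
qed

text \<open>A strictly monotone relabelling \<open>h\<close> has a monotone inverse \<open>g\<close>
  on the letters used, so relabelling blockwise is a bijection between the cuttings of
  \<open>w\<close> and of \<open>map h w\<close>.\<close>

lemma order_invariant_block_sum:
  assumes P: "\<And>h p q. strict_mono_on (set p \<union> set q) h \<Longrightarrow> block p \<Longrightarrow> block q \<Longrightarrow>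
     P (map h p) (map h q) \<longleftrightarrow> P p q"
  shows "order_invariant (block_sum P z)"
  unfolding order_invariant_def
proof (intro allI impI)
  fix h :: "nat \<Rightarrow> nat" and w
  assume h: "strict_mono_on (set w) h"
  have inj: "inj_on h (set w)"
    using h unfolding inj_on_def strict_mono_on_def by (metis less_irrefl nat_neq_iff)
  define g where "g = inv_into (set w) h"
  have gh: "g (h x) = x" if "x \<in> set w" for x
    using inj that by (simp add: g_def)
  have g: "strict_mono_on (set (map h w)) g"
    using h by (auto simp: strict_mono_on_def gh strict_mono_on_less[OF h])
  have w: "map g (map h w) = w"
    by (simp add: gh map_idI)
  have succ: "successively P (map (map h) bs) \<longleftrightarrow> successively P bs" if bs: "bs \<in> blocklists w" for bs
  proof -
    have "P (map h p) (map h q) \<longleftrightarrow> P p q" if "p \<in> set bs" "q \<in> set bs" for p q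
    proof (rule P)
      show "strict_mono_on (set p \<union> set q) h"
        using bs that by (intro monotone_on_subset[OF h]) (auto simp: blocklists_def)
    qed (use bs that in \<open>auto simp: blocklists_def\<close>)
    then show ?thesis
      unfolding successively_map by (intro successively_cong) auto
  qed
  show "block_sum P z (map h w) = block_sum P z w"
    unfolding block_sum_def
  proof (rule sum.reindex_bij_witness[where i = "map (map h)" and j = "map (map g)"])
    fix bs assume bs: "bs \<in> blocklists (map h w)"
    have m: "map (map g) bs \<in> blocklists w"
      using map_blocklists[OF g bs] w by simp
    have "h (g x) = x" if "b \<in> set bs" "x \<in> set b" for b x
    proof -
      have "set (concat bs) = set (map h w)"
        using bs by (simp add: blocklists_def)
      then have "x \<in> h ` set w"
        using that by auto
      then show ?thesis by (auto simp: gh)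
    qed
    then show hg: "map (map h) (map (map g) bs) = bs"
      by (auto intro!: map_idI)
    show "map (map g) bs \<in> blocklists w"
      by (rule m)
    show "of_bool (successively P (map (map g) bs)) * z ^ length (map (map g) bs) =
      of_bool (successively P bs) * z ^ length bs"
      using succ[OF m] hg by simp
  next
    fix bs assume bs: "bs \<in> blocklists w"
    then show "map (map h) bs \<in> blocklists (map h w)"
      by (rule map_blocklists[OF h])
    have "g (h x) = x" if "b \<in> set bs" "x \<in> set b" for b x
      using that bs by (intro gh) (auto simp: blocklists_def)
    then show "map (map g) (map (map h) bs) = bs"
      by (auto intro!: map_idI)
  qed
qed

lemma order_invariant_block_sum_link: "order_invariant (block_sum link z)"
proof (rule order_invariant_block_sum)
  fix h :: "nat \<Rightarrow> nat" and p q
  assume h: "strict_mono_on (set p \<union> set q) h" and "block p" "block q"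
  then have ne: "p \<noteq> []" "q \<noteq> []" by (auto simp: block_def)
  have less: "h x < h z \<longleftrightarrow> x < z" if "x \<in> set p \<union> set q" "z \<in> set p \<union> set q" for x z
    using that by (rule strict_mono_on_less[OF h])
  have "last (map h p) < hd (map h q) \<longleftrightarrow> last p < hd q"
    using ne by (simp add: last_map hd_map less)
  moreover have "link1324 (map h p) (map h q) \<longleftrightarrow> link1324 p q"
  proof
    assume "link1324 (map h p) (map h q)"
    then obtain a b c d where "p = [a, c]" "q = [b, d]" "h a < h b" "h b < h c" "h c < h d"
      by (auto simp: link1324_def)
    then show "link1324 p q"
      by (simp add: link1324_def less)
  qed (auto simp: link1324_def less)
  ultimately show "link (map h p) (map h q) \<longleftrightarrow> link p q"
    by (simp add: link_def)
qed

section \<open>Unlinked cuttings and ascending runs\<close>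

fun runs :: "nat list \<Rightarrow> nat list list" where
  "runs (a # c # w) = (if a < c then [a, c] # runs w else [a] # runs (c # w))"
| "runs [a] = [[a]]"
| "runs [] = []"

text \<open>An unlinked cutting never separates the two letters of an ascent, so it is forced to be
  the one into ascending runs. Blocks have at most two letters, which excludes 123; the second
  alternative in \<open>link\<close> excludes 1324.\<close>

lemma unlinked_blocklist_iff_runs:
  "distinct w \<Longrightarrow> bs \<in> blocklists w \<and> successively (\<lambda>p q. \<not> link p q) bs \<longleftrightarrow> avoids w \<and> bs = runs w"
proof (induction w arbitrary: bs rule: runs.induct)
  case (1 a c w)
  show ?case
  proof (cases "a < c")
    case True
    note IH = "1.IH"(1)[OF True]
    \<comment> \<open>A pattern starting at \<open>c\<close> would begin with an ascent from
      \<open>c\<close>, which together with \<open>a < c\<close> is already a 123 starting at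
      \<open>a\<close>. So only patterns starting at \<open>a\<close> have to be excluded.\<close>
    have av: "avoids (a # c # w) \<longleftrightarrow> avoids w \<and> (w \<noteq> [] \<longrightarrow> \<not> link [a, c] (hd (runs w)))"
    proof (cases w)
      case (Cons b v)
      show ?thesis
      proof (cases v)
        case (Cons d u)
        then show ?thesis
          using True \<open>w = b # v\<close> "1.prems" by (auto simp: link_def link1324_def)
      qed (use True Cons "1.prems" in \<open>auto simp: link_def link1324_def\<close>)
    qed simp
    have ne: "runs w = [] \<longleftrightarrow> w = []"
      by (cases w rule: runs.cases) auto
    have "bs \<in> blocklists (a # c # w) \<and> successively (\<lambda>p q. \<not> link p q) bs \<longleftrightarrow>
      (\<exists>bs'. bs = [a, c] # bs' \<and> bs' \<in> blocklists w \<and> successively (\<lambda>p q. \<not> link p q) ([a, c] # bs'))"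
      using True by (auto simp: blocklists_Cons link_def)
    also have "\<dots> \<longleftrightarrow> (\<exists>bs'. bs = [a, c] # bs' \<and> (bs' \<in> blocklists w \<and> successively (\<lambda>p q. \<not> link p q) bs')
      \<and> (bs' \<noteq> [] \<longrightarrow> \<not> link [a, c] (hd bs')))"
      by (auto simp: successively_Cons)
    also have "\<dots> \<longleftrightarrow> avoids (a # c # w) \<and> bs = runs (a # c # w)"
      using IH "1.prems" True by (auto simp: av ne)
    finally show ?thesis .
  next
    case False
    note IH = "1.IH"(2)[OF False]
    have av: "avoids (a # c # w) \<longleftrightarrow> avoids (c # w)"
      using False by (cases w) auto
    have hd: "\<not> link [a] (hd bs')" if "bs' \<in> blocklists (c # w)" for bs'
      using that False by (auto simp: blocklists_Cons link_def link1324_def)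
    have "bs \<in> blocklists (a # c # w) \<and> successively (\<lambda>p q. \<not> link p q) bs \<longleftrightarrow>
      (\<exists>bs'. bs = [a] # bs' \<and> bs' \<in> blocklists (c # w) \<and> successively (\<lambda>p q. \<not> link p q) ([a] # bs'))"
      using False by (auto simp: blocklists_Cons[of _ a])
    also have "\<dots> \<longleftrightarrow> (\<exists>bs'. bs = [a] # bs' \<and> (bs' \<in> blocklists (c # w) \<and> successively (\<lambda>p q. \<not> link p q) bs'))"
      using hd by (auto simp: successively_Cons)
    also have "\<dots> \<longleftrightarrow> avoids (a # c # w) \<and> bs = runs (a # c # w)"
      using IH "1.prems" False by (auto simp: av)
    finally show ?thesis .
  qed
next
  case (2 a)
  then show ?case by (auto simp: blocklists_Cons)
next
  case 3
  then show ?case by auto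
qed

text \<open>Avoiding 123 makes every boundary between consecutive runs a descent, and no descent
  lies inside a run.\<close>

lemma length_runs:
  "distinct w \<Longrightarrow> avoids w \<Longrightarrow> w \<noteq> [] \<Longrightarrow> length (runs w) = Suc (des w)"
proof (induction w rule: runs.induct)
  case (1 a c w)
  show ?case
  proof (cases w)
    case (Cons b v)
    have "avoids w"
      using "1.prems"(2) Cons by (cases v) auto
    then show ?thesis
      using 1 Cons by auto
  qed (use 1 in auto)
qed auto

text \<open>At most one cutting contributes, namely \<open>runs w\<close>. The empty word has no
  blocks, hence weight 1 and not \<open>z ^ Suc 0\<close>.\<close>

lemma block_sum_not_link:
  assumes "distinct w"
  shows "block_sum (\<lambda>p q. \<not> link p q) z w = (if w = [] then 1 else of_bool (avoids w) * z ^ Suc (des w))"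
proof -
  have "block_sum (\<lambda>p q. \<not> link p q) z w =
    (\<Sum>bs | bs \<in> blocklists w \<and> successively (\<lambda>p q. \<not> link p q) bs. z ^ length bs)"
    unfolding block_sum_def by (rule sum.mono_neutral_cong_right) auto
  also have "{bs. bs \<in> blocklists w \<and> successively (\<lambda>p q. \<not> link p q) bs} = {bs. avoids w \<and> bs = runs w}"
    using unlinked_blocklist_iff_runs[OF assms] by simp
  finally show ?thesis
    using assms length_runs[of w] by (cases "avoids w") auto
qed

subsection \<open>Ballot numbers\<close>

text \<open>
  Reading \<open>1, \<dots>, p + q\<close> in order and noting which list contains each number gives a ballot sequence:
  the first list stays strictly ahead.
\<close>

definition ballot :: "nat \<Rightarrow> nat \<Rightarrow> (nat list \<times> nat list) set" where
  "ballot p q = {(as, cs). length as = p \<and> length cs = q \<and> sorted_wrt (<) as \<and> sorted_wrt (<) cs \<and>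
     set as \<union> set cs = {1..p + q} \<and> (\<forall>i<q. as ! Suc i < cs ! i)}"

lemma sorted_wrt_less_max_last:
  fixes n :: nat
  assumes "sorted_wrt (<) xs" "n \<in> set xs" "\<forall>x\<in>set xs. x \<le> n"
  obtains ys where "xs = ys @ [n]"
proof (cases xs rule: rev_cases)
  case (snoc ys z)
  have "n = z"
    using assms snoc by (auto simp: sorted_wrt_append)
  then show ?thesis
    using snoc that by blast
qed (use assms in simp)

lemma finite_ballot [simp]: "finite (ballot p q)"
proof (rule finite_subset)
  let ?L = "\<lambda>k. {xs. set xs \<subseteq> {1..p + q} \<and> length xs = k}"
  show "ballot p q \<subseteq> ?L p \<times> ?L q"
    by (auto simp: ballot_def)
  show "finite (?L p \<times> ?L q)"
    by (simp add: finite_lists_length_eq)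
qed

text \<open>Delete the largest number, which ends one of the two lists. It can end the first list
  only for \<open>q < r\<close>, since for \<open>q = r\<close> the condition
  \<open>as ! r < cs ! (r - 1)\<close> puts something above it. The excluded
  \<open>ballot 1 0\<close> is the base case, where the right-hand side would be empty.\<close>

lemma ballot_rec:
  assumes "q \<le> r" and "r + q \<noteq> 0"
  shows "ballot (Suc r) q =
    (if q < r then (\<lambda>(as, cs). (as @ [Suc r + q], cs)) ` ballot r q else {}) \<union>
    (if q = 0 then {} else (\<lambda>(as, cs). (as, cs @ [Suc r + q])) ` ballot (Suc r) (q - 1))"
    (is "_ = ?A \<union> ?C")
proof (intro equalityI subsetI)
  fix s assume "s \<in> ballot (Suc r) q"
  then obtain as cs where s: "s = (as, cs)" and len: "length as = Suc r" "length cs = q"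
    and srt: "sorted_wrt (<) as" "sorted_wrt (<) cs"
    and un: "set as \<union> set cs = {1..Suc r + q}" and lt: "\<forall>i<q. as ! Suc i < cs ! i"
    by (auto simp: ballot_def)
  have "distinct (as @ cs)"
    using len un by (intro card_distinct) simp
  then have disj: "set as \<inter> set cs = {}" by simp
  have le: "\<forall>x\<in>set as \<union> set cs. x \<le> Suc r + q"
    using un by simp
  have "Suc r + q \<in> set as \<union> set cs"
    using un by simp
  then show "s \<in> ?A \<union> ?C"
  proof
    assume "Suc r + q \<in> set as"
    then obtain ys where ys: "as = ys @ [Suc r + q]"
      using srt(1) le sorted_wrt_less_max_last by (metis UnCI)
    have q: "q < r"
    proof (rule ccontr)
      assume "\<not> q < r"
      then have "q = r" "r \<noteq> 0"
        using assms by auto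
      then have "as ! r < cs ! (r - 1)"
        using lt[rule_format, of "r - 1"] by simp
      moreover have "as ! r = Suc r + q"
        using ys len by (simp add: nth_append)
      moreover have "cs ! (r - 1) \<in> set cs"
        using len \<open>q = r\<close> \<open>r \<noteq> 0\<close> by simp
      moreover from this have "cs ! (r - 1) \<le> Suc r + q"
        using le by blast
      ultimately show False by simp
    qed
    have "set ys \<union> set cs = (set as \<union> set cs) - {Suc r + q}"
      using ys disj srt(1) by (auto simp: sorted_wrt_append)
    also have "\<dots> = {1..r + q}"
      unfolding un by auto
    finally have "(ys, cs) \<in> ballot r q"
      using len srt lt ys q by (auto simp: ballot_def sorted_wrt_append nth_append)
    then show ?thesis
      using q s ys by auto
  next
    assume "Suc r + q \<in> set cs"
    then obtain ys where ys: "cs = ys @ [Suc r + q]"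
      using srt(2) le sorted_wrt_less_max_last by (metis UnCI)
    then have q: "q \<noteq> 0"
      using len by auto
    have "set as \<union> set ys = (set as \<union> set cs) - {Suc r + q}"
      using ys disj srt(2) by (auto simp: sorted_wrt_append)
    also have "\<dots> = {1..Suc r + (q - 1)}"
      unfolding un using q by auto
    finally have "(as, ys) \<in> ballot (Suc r) (q - 1)"
      using len srt lt ys q by (auto simp: ballot_def sorted_wrt_append nth_append split: if_splits)
    then show ?thesis
      using q s ys by auto
  qed
next
  fix s assume "s \<in> ?A \<union> ?C"
  then show "s \<in> ballot (Suc r) q"
  proof
    assume "s \<in> ?A"
    then obtain as cs where q: "q < r" and *: "(as, cs) \<in> ballot r q" and s: "s = (as @ [Suc r + q], cs)"
      by (auto split: if_splits)
    from * have "set as \<subseteq> {1..r + q}" and un: "set as \<union> set cs = {1..r + q}"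
      by (auto simp: ballot_def)
    moreover have "{1..Suc r + q} = insert (Suc r + q) {1..r + q}" by auto
    ultimately show ?thesis
      using q * by (auto simp: s ballot_def sorted_wrt_append nth_append)
  next
    assume "s \<in> ?C"
    then obtain as cs where q: "q \<noteq> 0" and *: "(as, cs) \<in> ballot (Suc r) (q - 1)"
      and s: "s = (as, cs @ [Suc r + q])"
      by (auto split: if_splits)
    from * have un: "set as \<union> set cs = {1..Suc r + (q - 1)}"
      and len: "length as = Suc r" "length cs = q - 1"
      by (auto simp: ballot_def)
    have "\<forall>x\<in>set as \<union> set cs. x < Suc r + q"
      using q unfolding un by auto
    then have lt: "\<forall>x\<in>set as. x < Suc r + q" "\<forall>x\<in>set cs. x < Suc r + q" by auto
    \<comment> \<open>Only \<open>i = q - 1\<close> is new: there an entry of \<open>as\<close>,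
      which exists because \<open>q \<le> r\<close>, is compared with the appended maximum.\<close>
    have "as ! Suc i < (cs @ [Suc r + q]) ! i" if "i < q" for i
    proof (cases "i < q - 1")
      case True
      then show ?thesis using * by (auto simp: ballot_def nth_append)
    next
      case False
      then have "i = q - 1" using that by simp
      then show ?thesis
        using len assms q lt by (simp add: nth_append)
    qed
    moreover have "{1..Suc r + q} = insert (Suc r + q) {1..Suc r + (q - 1)}"
      using q by auto
    ultimately show ?thesis
      using q * lt by (auto simp: s ballot_def sorted_wrt_append)
  qed
qed

text \<open>The ballot number as a difference of two binomials, stated additively to avoid truncated
  subtraction. Both sides obey Pascal's rule, by \<open>ballot_rec\<close> for the left one.\<close>

lemma card_ballot:
  "q \<le> r \<Longrightarrow> card (ballot (Suc r) q) + (r + q choose Suc r) = (r + q choose r)"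
proof (induction "r + q" arbitrary: r q)
  case 0
  have "s \<in> ballot 1 0 \<longleftrightarrow> s = ([1], [])" for s
  proof (cases s)
    case (Pair as cs)
    then show ?thesis
      by (cases as; cases "tl as") (auto simp: ballot_def)
  qed
  then have "ballot (Suc 0) 0 = {([1], [])}" by auto
  with 0 show ?case by simp
next
  case (Suc n)
  obtain r' where r: "r = Suc r'"
    using Suc.prems Suc.hyps(2) by (cases r) auto
  have n: "n = r' + q" and rq: "r + q = Suc n"
    using Suc.hyps(2) r by simp_all
  have IH1: "card (ballot r q) + (n choose r) = (n choose r')" if "q < r"
    using Suc.hyps(1)[OF n] that by (simp add: n r)
  have IH2: "card (ballot (Suc r) (q - 1)) + (n choose Suc r) = (n choose r)" if "q \<noteq> 0"
  proof -
    have "n = r + (q - 1)"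
      using n r that by simp
    from Suc.hyps(1)[OF this] show ?thesis
      using Suc.prems unfolding \<open>n = r + (q - 1)\<close> by simp
  qed
  let ?A = "if q < r then (\<lambda>(as, cs). (as @ [Suc r + q], cs)) ` ballot r q else {}"
  let ?C = "if q = 0 then {} else (\<lambda>(as, cs). (as, cs @ [Suc r + q])) ` ballot (Suc r) (q - 1)"
  have disj: "?A \<inter> ?C = {}"
  proof -
    have "Suc r + q \<notin> set as" if "(as, cs) \<in> ballot (Suc r) (q - 1)" "q \<noteq> 0" for as cs
    proof
      assume "Suc r + q \<in> set as"
      moreover have "set as \<subseteq> {1..Suc r + (q - 1)}"
        using that(1) unfolding ballot_def by blast
      ultimately have "Suc r + q \<in> {1..Suc r + (q - 1)}" by blast
      then show False using that(2) by auto
    qed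
    moreover have "Suc r + q \<in> set (fst s)" if "s \<in> ?A" for s
      using that by (auto split: if_splits)
    moreover have "q \<noteq> 0 \<and> (\<exists>cs. (fst s, cs) \<in> ballot (Suc r) (q - 1))" if "s \<in> ?C" for s
      using that by (auto split: if_splits)
    ultimately show ?thesis by blast
  qed
  have cardA: "card ?A = (if q < r then card (ballot r q) else 0)"
    by (auto intro!: card_image inj_onI)
  have cardC: "card ?C = (if q = 0 then 0 else card (ballot (Suc r) (q - 1)))"
    by (auto intro!: card_image inj_onI)
  have "ballot (Suc r) q = ?A \<union> ?C"
    using rq by (intro ballot_rec Suc.prems) simp
  then have "card (ballot (Suc r) q) = card (?A \<union> ?C)"
    by (rule arg_cong)
  also have "\<dots> = card ?A + card ?C"
    using disj by (intro card_Un_disjoint) auto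
  finally have card: "card (ballot (Suc r) q) =
    (if q < r then card (ballot r q) else 0) + (if q = 0 then 0 else card (ballot (Suc r) (q - 1)))"
    unfolding cardA cardC .
  \<comment> \<open>On the diagonal the first branch of the recursion is missing; the symmetry of
    the binomials says that its contribution would be zero.\<close>
  have sym: "(n choose r) = (n choose r')" if "q = r"
    using binomial_symmetric[of r n] that n r by simp
  have pascal: "(r + q choose Suc r) = (n choose r) + (n choose Suc r)"
    "(r + q choose r) = (n choose r') + (n choose r)"
    by (simp_all add: n r)
  have zero: "(n choose r) = 0" "(n choose Suc r) = 0" if "q = 0"
    using that n r by (simp_all add: binomial_eq_0)
  consider "q = 0" "q < r" | "q \<noteq> 0" "q < r" | "q \<noteq> 0" "q = r"
    using Suc.prems r by linarith
  then show ?case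
  proof cases
    case 1
    then show ?thesis
      unfolding pascal card using IH1 zero by simp
  next
    case 2
    then show ?thesis
      unfolding pascal card using IH1 IH2 by simp
  next
    case 3
    then show ?thesis
      unfolding pascal card using IH2 sym by simp
  qed
qed

text \<open>Absorption gives \<open>(r + 1) * (2 r choose r + 1) = r * (2 r choose r)\<close>;
  subtracting this from \<open>r + 1\<close> copies of the central binomial leaves one copy.\<close>

lemma card_ballot_eq_catalan:
  "of_nat (card (ballot (Suc r) r)) = (catalan r :: 'a::field_char_0)"
proof -
  have "Suc r * (2 * r choose Suc r) = 2 * r * (2 * r - 1 choose r)"
    by (rule binomial_absorption)
  also have "\<dots> = (2 * r - r) * (2 * r choose r)"
    by (rule binomial_absorb_comp[symmetric])
  also have "2 * r - r = r" by simp
  finally have "Suc r * (2 * r choose Suc r) = r * (2 * r choose r)" .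
  moreover have "card (ballot (Suc r) r) + (2 * r choose Suc r) = (2 * r choose r)"
    using card_ballot[of r r] by (simp add: mult_2)
  then have "Suc r * card (ballot (Suc r) r) + Suc r * (2 * r choose Suc r) = Suc r * (2 * r choose r)"
    by (simp only: flip: distrib_left)
  ultimately have "Suc r * card (ballot (Suc r) r) = (2 * r choose r)"
    by simp
  then have "of_nat (Suc r) * of_nat (card (ballot (Suc r) r)) = (of_nat (2 * r choose r) :: 'a)"
    by (metis of_nat_mult)
  then show ?thesis
    by (simp add: catalan_def field_simps del: of_nat_Suc)
qed

subsection \<open>Decomposition of clusters into chains\<close>

text \<open>The permutation is \<open>concat bs\<close>, so a permutation together with its cutting
  is represented by the block list alone.\<close>

definition block_perms :: "(nat list \<Rightarrow> nat list \<Rightarrow> bool) \<Rightarrow> nat set \<Rightarrow> nat list list set" where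
  "block_perms P A = {bs. concat bs \<in> permutations_of_set A \<and> (\<forall>b\<in>set bs. block b) \<and> successively P bs}"

lemma finite_block_perms [simp]: "finite (block_perms P A)"
proof (rule finite_subset)
  show "block_perms P A \<subseteq> (\<Union>w\<in>permutations_of_set A. blocklists w)"
    by (auto simp: block_perms_def blocklists_def)
qed simp

lemma sum_block_sum_permutations:
  "(\<Sum>w\<in>permutations_of_set A. block_sum P z w) = (\<Sum>bs\<in>block_perms P A. z ^ length bs)"
proof -
  have "(\<Sum>w\<in>permutations_of_set A. block_sum P z w) =
    (\<Sum>w\<in>permutations_of_set A. \<Sum>bs | bs \<in> blocklists w \<and> successively P bs. z ^ length bs)"
    unfolding block_sum_def by (intro sum.cong refl sum.mono_neutral_cong_right) auto
  also have "\<dots> = (\<Sum>(w, bs)\<in>(SIGMA w:permutations_of_set A. {bs. bs \<in> blocklists w \<and> successively P bs}). z ^ length bs)"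
    by (subst sum.Sigma) auto
  also have "\<dots> = (\<Sum>bs\<in>block_perms P A. z ^ length bs)"
    by (rule sum.reindex_bij_witness[where i = "\<lambda>bs. (concat bs, bs)" and j = snd])
      (auto simp: block_perms_def blocklists_def)
  finally show ?thesis .
qed

text \<open>Each block starts with its minimum, and both kinds of link make the first letters
  increase from block to block.\<close>

lemma hd_hd_le_if_linked:
  "successively link bs \<Longrightarrow> \<forall>b\<in>set bs. block b \<Longrightarrow> x \<in> set (concat bs) \<Longrightarrow> hd (hd bs) \<le> x"
proof (induction bs)
  case (Cons b bs)
  have b: "hd b \<le> last b" "\<forall>x\<in>set b. hd b \<le> x"
    using Cons.prems by (auto simp: block_def)
  show ?case
  proof (cases "x \<in> set b")
    case False
    then have x: "x \<in> set (concat bs)" and "bs \<noteq> []"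
      using Cons.prems by auto
    then have "hd (hd bs) \<le> x" "link b (hd bs)"
      using Cons by (auto simp: successively_Cons)
    then show ?thesis
      using b by (auto simp: link_def link1324_def)
  qed (use b in auto)
qed simp

text \<open>Each block ends with its maximum, and 1324-links make these last letters
  increase.\<close>

lemma le_last_last_if_chain:
  "successively link1324 bs \<Longrightarrow> \<forall>b\<in>set bs. block b \<Longrightarrow> x \<in> set (concat bs) \<Longrightarrow> x \<le> last (last bs)"
proof (induction bs arbitrary: x)
  case (Cons b bs)
  have b: "\<forall>x\<in>set b. x \<le> last b"
    using Cons.prems by (auto simp: block_def)
  show ?case
  proof (cases "bs = []")
    case False
    then have link: "link1324 b (hd bs)"
      using Cons.prems by (simp add: successively_Cons)
    then have "last b < last (hd bs)" "last (hd bs) \<in> set (concat bs)"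
      using False by (cases bs; auto simp: link1324_def)+
    moreover have "y \<le> last (last bs)" if "y \<in> set (concat bs)" for y
      using Cons that False by (simp add: successively_Cons)
    ultimately show ?thesis
      using b False Cons.prems(3) by fastforce
  qed (use b Cons.prems in auto)
qed simp

text \<open>Cut at the first place where \<open>last p < hd q\<close>; all links before it are
  1324-links.\<close>

lemma successively_link_imp_chain_prefix:
  "successively link bs \<Longrightarrow> bs \<noteq> [] \<Longrightarrow>
    \<exists>ps qs. bs = ps @ qs \<and> ps \<noteq> [] \<and> successively link1324 ps \<and> successively link qs \<and>
      (qs \<noteq> [] \<longrightarrow> last (last ps) < hd (hd qs))"
proof (induction bs rule: induct_list012)
  case (2 b)
  then show ?case by (intro exI[of _ "[b]"] exI[of _ "[]"]) simp
next
  case (3 b c bs)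
  show ?case
  proof (cases "last b < hd c")
    case True
    then show ?thesis
      using 3 by (intro exI[of _ "[b]"] exI[of _ "c # bs"]) simp
  next
    case False
    obtain ps qs where *: "c # bs = ps @ qs" "ps \<noteq> []" "successively link1324 ps" "successively link qs"
      "qs \<noteq> [] \<longrightarrow> last (last ps) < hd (hd qs)"
      using 3 by auto
    moreover have "link1324 b (hd ps)"
      using False 3 * by (cases ps) (auto simp: link_def)
    ultimately show ?thesis
      by (intro exI[of _ "b # ps"] exI[of _ qs]) (auto simp: successively_Cons)
  qed
qed simp

lemma initial_segment_if_less:
  fixes X Y :: "nat set"
  assumes "X \<union> Y = {1..n}" "X \<noteq> {}" "\<forall>x\<in>X. \<forall>y\<in>Y. x < y"
  obtains m where "m \<in> {1..n}" "X = {1..m}" "Y = {Suc m..n}"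
proof
  let ?m = "Max X"
  have fin: "finite X"
    using assms(1) by (metis finite_Un finite_atLeastAtMost)
  have m: "?m \<in> X" "\<forall>x\<in>X. x \<le> ?m"
    using fin assms(2) by auto
  show "?m \<in> {1..n}"
    using m assms(1) by auto
  show "X = {1..?m}"
  proof (intro equalityI subsetI)
    fix x assume x: "x \<in> {1..?m}"
    then have "x \<in> X \<union> Y"
      using \<open>?m \<in> {1..n}\<close> assms(1) by auto
    then show "x \<in> X"
      using x m assms(3) by fastforce
  qed (use m assms(1) in auto)
  show "Y = {Suc ?m..n}"
  proof (intro equalityI subsetI)
    fix y assume "y \<in> Y"
    then have "?m < y" "y \<in> {1..n}"
      using m assms by blast+
    then show "y \<in> {Suc ?m..n}" by simp
  next
    fix y assume y: "y \<in> {Suc ?m..n}"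
    then have "y \<in> X \<union> Y"
      using assms(1) by auto
    then show "y \<in> Y"
      using y m by fastforce
  qed
qed

text \<open>The first chain lies below everything after it and therefore uses the values
  \<open>1..m\<close> for some \<open>m\<close>. For \<open>n = 0\<close> there is no such
  \<open>m\<close>, although the empty block list is a cluster.\<close>

lemma bij_betw_chain_append:
  assumes "n \<noteq> 0"
  shows "bij_betw (\<lambda>(m, ps, qs). ps @ qs)
    (SIGMA m:{1..n}. block_perms link1324 {1..m} \<times> block_perms link {Suc m..n}) (block_perms link {1..n})"
    (is "bij_betw ?f ?S _")
  unfolding bij_betw_def
proof
  have set: "set (concat bs) = A" if "bs \<in> block_perms P A" for P bs A
    using that by (simp only: block_perms_def mem_Collect_eq permutations_of_setD)
  \<comment> \<open>Uniqueness of the cut: if the chain continued from \<open>ps\<close> into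
    \<open>us\<close>, the 1324-link would need a letter of \<open>us\<close> below a letter of
    \<open>ps\<close>, but the letters of \<open>ps\<close> are at most \<open>m\<close> and those
    of \<open>us\<close> exceed \<open>m\<close>.\<close>
  have prefix: "us = []" if "(m, ps, us @ qs) \<in> ?S" "ps @ us \<in> block_perms link1324 {1..k}" for m ps us qs k
  proof (rule ccontr)
    assume "us \<noteq> []"
    have "ps \<noteq> []"
      using that(1) set[of ps link1324 "{1..m}"] by auto
    with \<open>us \<noteq> []\<close> have "link1324 (last ps) (hd us)"
      using that(2) by (simp add: block_perms_def successively_append_iff)
    then obtain a b c d where abcd: "last ps = [a, c]" "hd us = [b, d]" "b < c"
      by (auto simp: link1324_def)
    have "c \<in> set (concat ps)"
      unfolding set_concat using abcd(1) last_in_set[OF \<open>ps \<noteq> []\<close>] by (metis UN_I list.set_intros)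
    then have "c \<le> m"
      using that(1) set[of ps link1324 "{1..m}"] by auto
    have "b \<in> set (concat (us @ qs))"
      unfolding set_concat set_append using abcd(2) hd_in_set[OF \<open>us \<noteq> []\<close>]
      by (metis UN_I UnI1 list.set_intros(1))
    moreover have "set (concat (us @ qs)) = {Suc m..n}"
      using that(1) by (intro set) auto
    ultimately have "b \<in> {Suc m..n}" by blast
    then have "m < b" by simp
    with \<open>c \<le> m\<close> \<open>b < c\<close> show False by simp
  qed
  show "inj_on ?f ?S"
  proof (rule inj_onI)
    fix s s' assume "s \<in> ?S" "s' \<in> ?S" "?f s = ?f s'"
    then obtain m ps qs m' ps' qs' where ss: "s = (m, ps, qs)" "s' = (m', ps', qs')"
      and S: "m \<in> {1..n}" "ps \<in> block_perms link1324 {1..m}" "qs \<in> block_perms link {Suc m..n}"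
      and S': "m' \<in> {1..n}" "ps' \<in> block_perms link1324 {1..m'}" "qs' \<in> block_perms link {Suc m'..n}"
      and eq: "ps @ qs = ps' @ qs'"
      by auto
    obtain us where "ps = ps' @ us \<and> us @ qs = qs' \<or> ps @ us = ps' \<and> qs = us @ qs'"
      using eq unfolding append_eq_append_conv2 by blast
    then have "ps = ps' \<and> qs = qs'"
    proof
      assume us: "ps = ps' @ us \<and> us @ qs = qs'"
      with S S' have "us = []"
        by (intro prefix[of m' ps' us qs m]) auto
      with us show ?thesis by simp
    next
      assume us: "ps @ us = ps' \<and> qs = us @ qs'"
      with S S' have "us = []"
        by (intro prefix[of m ps us qs' m']) auto
      with us show ?thesis by simp
    qed
    moreover from this have "{1..m} = {1..m'}"
      using set[OF S(2)] set[OF S'(2)] by simp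
    then have "m = m'"
      by (metis card_atLeastAtMost diff_Suc_1)
    ultimately show "s = s'"
      by (simp add: ss)
  qed
  show "?f ` ?S = block_perms link {1..n}"
  proof (intro equalityI subsetI)
    fix bs assume "bs \<in> ?f ` ?S"
    then obtain m ps qs where m: "m \<in> {1..n}" and ps: "ps \<in> block_perms link1324 {1..m}"
      and qs: "qs \<in> block_perms link {Suc m..n}" and bs: "bs = ps @ qs"
      by auto
    \<comment> \<open>The joint is a link of the first kind, since all of \<open>ps\<close> lies
      below all of \<open>qs\<close>.\<close>
    have "link (last ps) (hd qs)" if "ps \<noteq> []" "qs \<noteq> []"
    proof -
      have "block (last ps)" "block (hd qs)"
        using ps qs last_in_set[OF that(1)] hd_in_set[OF that(2)] by (simp_all add: block_perms_def)
      then have "last (last ps) \<in> set (last ps)" "hd (hd qs) \<in> set (hd qs)"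
        by (auto simp: block_def)
      then have "last (last ps) \<in> set (concat ps)" "hd (hd qs) \<in> set (concat qs)"
        unfolding set_concat using last_in_set[OF that(1)] hd_in_set[OF that(2)] by blast+
      then have "last (last ps) \<in> {1..m}" "hd (hd qs) \<in> {Suc m..n}"
        using set[OF ps] set[OF qs] by blast+
      then show ?thesis
        by (simp add: link_def)
    qed
    moreover have "successively link ps"
      using ps by (auto simp: block_perms_def link_def intro: successively_mono)
    moreover have "{1..m} \<union> {Suc m..n} = {1..n}"
      using m by auto
    ultimately show "bs \<in> block_perms link {1..n}"
      using ps qs by (auto simp: bs block_perms_def permutations_of_set_def successively_append_iff)
  next
    fix bs assume bs: "bs \<in> block_perms link {1..n}"
    have "bs \<noteq> []"
      using set[OF bs] assms by auto
    moreover have "successively link bs"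
      using bs by (simp add: block_perms_def)
    ultimately obtain ps qs where *: "bs = ps @ qs" "ps \<noteq> []" "successively link1324 ps" "successively link qs"
      "qs \<noteq> [] \<longrightarrow> last (last ps) < hd (hd qs)"
      using successively_link_imp_chain_prefix[of bs] by blast
    have bl: "\<forall>b\<in>set ps. block b" "\<forall>b\<in>set qs. block b"
      using bs * by (auto simp: block_perms_def)
    have "x < y" if "x \<in> set (concat ps)" "y \<in> set (concat qs)" for x y
    proof -
      have "qs \<noteq> []" using that by auto
      then show ?thesis
        using le_last_last_if_chain[OF *(3) bl(1) that(1)] hd_hd_le_if_linked[OF *(4) bl(2) that(2)] *(5)
        by simp
    qed
    moreover have "set (concat ps) \<noteq> {}"
      using bl(1) \<open>ps \<noteq> []\<close> by (cases ps) (auto simp: block_def)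
    moreover have "set (concat ps) \<union> set (concat qs) = {1..n}"
      using set[OF bs] * by simp
    ultimately obtain m where m: "m \<in> {1..n}" "set (concat ps) = {1..m}" "set (concat qs) = {Suc m..n}"
      using initial_segment_if_less[of "set (concat ps)" "set (concat qs)" n] by blast
    have "distinct (concat ps)" "distinct (concat qs)"
      using bs * by (auto simp: block_perms_def permutations_of_set_def simp del: distinct_concat_iff)
    with m bl * have "(m, ps, qs) \<in> ?S"
      by (simp add: block_perms_def permutations_of_set_def del: set_concat)
    then show "bs \<in> ?f ` ?S"
      using *(1) by force
  qed
qed

text \<open>The values of the first chain are forced, so this is an ordinary convolution without
  binomial coefficients. The remaining cluster on \<open>{Suc m..n}\<close> is relabelled by order
  invariance.\<close>

lemma sum_clusters_rec:
  fixes z :: "'a::comm_ring_1"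
  defines "u \<equiv> \<lambda>n. \<Sum>w\<in>permutations_of_set {1..n}. block_sum link z w"
  assumes "n \<noteq> 0"
  shows "u n = (\<Sum>m=1..n. (\<Sum>bs\<in>block_perms link1324 {1..m}. z ^ length bs) * u (n - m))"
proof -
  have u: "(\<Sum>bs\<in>block_perms link {Suc m..n}. z ^ length bs) = u (n - m)" for m
    unfolding u_def sum_block_sum_permutations[symmetric]
    by (intro sum_permutations_of_set_cong_card order_invariant_block_sum_link) auto
  have "u n = (\<Sum>bs\<in>block_perms link {1..n}. z ^ length bs)"
    by (simp add: u_def sum_block_sum_permutations)
  also have "\<dots> = (\<Sum>(m, ps, qs)\<in>(SIGMA m:{1..n}. block_perms link1324 {1..m} \<times> block_perms link {Suc m..n}).
      z ^ length (ps @ qs))"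
    using sum.reindex_bij_betw[OF bij_betw_chain_append[OF \<open>n \<noteq> 0\<close>], of "\<lambda>bs. z ^ length bs"]
    by (simp add: case_prod_unfold)
  also have "\<dots> = (\<Sum>m=1..n. \<Sum>(ps, qs)\<in>block_perms link1324 {1..m} \<times> block_perms link {Suc m..n}.
      z ^ length ps * z ^ length qs)"
    by (subst sum.Sigma) (auto simp: power_add)
  also have "\<dots> = (\<Sum>m=1..n. (\<Sum>bs\<in>block_perms link1324 {1..m}. z ^ length bs) * u (n - m))"
    by (simp add: sum_product sum.cartesian_product flip: u)
  finally show ?thesis .
qed

subsection \<open>Counting chains\<close>

lemma map2_pair_simps:
  assumes "length as = length ds"
  shows "map hd (map2 (\<lambda>a d. [a, d]) as ds) = as" "map last (map2 (\<lambda>a d. [a, d]) as ds) = ds"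
    "set (concat (map2 (\<lambda>a d. [a, d]) as ds)) = set as \<union> set ds"
    "length (concat (map2 (\<lambda>a d. [a, d]) as ds)) = 2 * length as"
  using assms by (induction as ds rule: list_induct2) auto

lemma map2_hd_last:
  "\<forall>b\<in>set bs. length b = 2 \<Longrightarrow> map2 (\<lambda>a d. [a, d]) (map hd bs) (map last bs) = bs"
proof (induction bs)
  case (Cons b bs)
  have "length b = 2"
    using Cons.prems by simp
  then have "[hd b, last b] = b"
    by (auto simp: length_Suc_conv numeral_2_eq_2)
  then show ?case
    using Cons by simp
qed simp

lemma length_2_if_chain:
  "successively link1324 bs \<Longrightarrow> 2 \<le> length bs \<Longrightarrow> b \<in> set bs \<Longrightarrow> length b = 2"
proof (induction bs rule: induct_list012)
  case (3 p q bs)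
  then have "length p = 2" "length q = 2"
    by (auto simp: link1324_def)
  then show ?case
    using 3 by (cases bs) auto
qed simp_all

text \<open>A block taking part in a 1324-link has two letters, so a single letter can only be a
  chain by itself, which \<open>2 \<le> m\<close> rules out.\<close>

lemma block_perms_link1324:
  assumes "bs \<in> block_perms link1324 {1..m}" "2 \<le> m"
  shows "\<forall>b\<in>set bs. length b = 2" "m = 2 * length bs"
proof -
  have len: "length (concat bs) = m"
    using assms length_finite_permutations_of_set by (fastforce simp: block_perms_def)
  show *: "\<forall>b\<in>set bs. length b = 2"
  proof (cases "2 \<le> length bs")
    case True
    then show ?thesis
      using assms length_2_if_chain by (auto simp: block_perms_def)
  next
    case False
    then consider "bs = []" | b where "bs = [b]"
      by (cases bs; cases "tl bs") auto
    then show ?thesis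
      using assms len by cases (auto simp: block_perms_def block_def)
  qed
  have "sum_list (map length bs) = 2 * length bs"
    using * by (induction bs) auto
  then show "m = 2 * length bs"
    using len by (simp add: length_concat)
qed

text \<open>The last entry of a chain is its maximum; it carries no information and is dropped.\<close>

lemma bij_betw_ballot_block_perms:
  "bij_betw (\<lambda>(as, cs). map2 (\<lambda>a d. [a, d]) as (cs @ [2 * Suc r]))
    (ballot (Suc r) r) (block_perms link1324 {1..2 * Suc r})"
    (is "bij_betw ?f ?B ?C")
proof (rule bij_betw_byWitness[where f' = "\<lambda>bs. (map hd bs, butlast (map last bs))"])
  let ?n = "2 * Suc r"
  let ?g = "\<lambda>bs. (map hd bs, butlast (map last bs)) :: nat list \<times> nat list"
  show "\<forall>s\<in>?B. ?g (?f s) = s"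
    by (auto simp: ballot_def map2_pair_simps simp del: map_map)
  show "?f ` ?B \<subseteq> ?C"
  proof (rule image_subsetI)
    fix s assume "s \<in> ?B"
    then obtain as cs where s: "s = (as, cs)" and len: "length as = Suc r" "length cs = r"
      and srt: "sorted_wrt (<) as" "sorted_wrt (<) cs"
      and un: "set as \<union> set cs = {1..Suc r + r}" and lt: "\<forall>i<r. as ! Suc i < cs ! i"
      by (auto simp: ballot_def)
    \<comment> \<open>The second letters of the blocks, with the dropped maximum restored.\<close>
    define ds where "ds = cs @ [?n]"
    define bs where "bs = map2 (\<lambda>a d. [a, d]) as ds"
    have len': "length ds = Suc r" "length bs = Suc r"
      using len by (simp_all add: ds_def bs_def)
    have "\<forall>x\<in>set as \<union> set cs. x < ?n"
      unfolding un by auto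
    then have less: "\<forall>x\<in>set as. x < ?n" "\<forall>x\<in>set cs. x < ?n" by auto
    have sd: "sorted_wrt (<) ds"
      using srt less by (simp add: ds_def sorted_wrt_append)
    have nth: "bs ! i = [as ! i, ds ! i]" if "i < Suc r" for i
      using that len len' by (simp add: bs_def)
    have as: "as ! i < as ! Suc i" if "i < r" for i
      using sorted_wrt_nth_less[OF srt(1), of i "Suc i"] that len by simp
    have asds: "as ! Suc i < ds ! i" if "i < r" for i
      using lt that len by (simp add: ds_def nth_append)
    have ds: "ds ! i < ds ! Suc i" if "i < r" for i
      using sorted_wrt_nth_less[OF sd, of i "Suc i"] that len' by simp
    have "block b" if b: "b \<in> set bs" for b
    proof -
      obtain i where i: "i < Suc r" "b = bs ! i"
        using b len' by (auto simp: in_set_conv_nth)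
      \<comment> \<open>Before the last block this follows through \<open>as ! Suc i\<close>; in the
        last block the second letter is the overall maximum.\<close>
      have "as ! i < ds ! i"
      proof (cases "i < r")
        case True
        then show ?thesis using as[of i] asds[of i] by simp
      next
        case False
        then have "i = r" using i by simp
        moreover have "as ! r \<in> set as"
          using len by simp
        ultimately show ?thesis
          using len less(1) by (simp add: ds_def nth_append)
      qed
      then show ?thesis
        using i nth by (auto simp: block_def)
    qed
    moreover have "successively link1324 bs"
      unfolding successively_conv_nth link1324_def
      using len' nth as asds ds by auto
    moreover have "concat bs \<in> permutations_of_set {1..?n}"
    proof
      have "set (concat bs) = insert ?n (set as \<union> set cs)"
        using map2_pair_simps(3)[of as ds] len len' by (simp add: bs_def ds_def)
      also have "\<dots> = {1..?n}"
        unfolding un by auto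
      finally show *: "set (concat bs) = {1..?n}" .
      have "length (concat bs) = ?n"
        using map2_pair_simps(4)[of as ds] len len' by (simp add: bs_def)
      with * show "distinct (concat bs)"
        by (intro card_distinct) (simp del: set_concat)
    qed
    ultimately have "bs \<in> ?C"
      by (simp add: block_perms_def)
    then show "?f s \<in> ?C"
      by (simp add: s bs_def ds_def)
  qed
  have chain: "?g bs \<in> ?B \<and> ?f (?g bs) = bs" if bs: "bs \<in> ?C" for bs
  proof -
    have two: "\<forall>b\<in>set bs. length b = 2" and len: "length bs = Suc r"
      using block_perms_link1324[OF bs] by simp_all
    define as where "as = map hd bs"
    define ds where "ds = map last bs"
    have bs_eq: "bs = map2 (\<lambda>a d. [a, d]) as ds"
      using map2_hd_last[OF two] by (simp add: as_def ds_def)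
    have len': "length as = Suc r" "length ds = Suc r"
      using len by (simp_all add: as_def ds_def)
    have nth: "bs ! i = [as ! i, ds ! i]" if "i < Suc r" for i
      using that len' by (subst bs_eq) simp
    have "set (concat bs) = {1..?n}"
      using bs by (simp only: block_perms_def mem_Collect_eq permutations_of_setD)
    then have un: "set as \<union> set ds = {1..?n}"
      using map2_pair_simps(3)[of as ds] len' bs_eq by simp
    have step: "as ! i < as ! Suc i \<and> as ! Suc i < ds ! i \<and> ds ! i < ds ! Suc i" if "i < r" for i
    proof -
      have "link1324 (bs ! i) (bs ! Suc i)"
        using bs that len by (simp add: block_perms_def successively_conv_nth)
      then show ?thesis
        using nth[of i] nth[of "Suc i"] that by (simp add: link1324_def)
    qed
    have srt: "sorted_wrt (<) as" "sorted_wrt (<) ds"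
      using step len' by (auto simp: sorted_wrt_iff_nth_Suc_transp)
    have asds: "as ! i < ds ! i" if "i < Suc r" for i
    proof -
      have "block (bs ! i)"
        using bs that len by (simp add: block_perms_def)
      then show ?thesis
        using nth[OF that] by (simp add: block_def)
    qed
    have le: "\<forall>x\<in>set as \<union> set ds. x \<le> ?n"
      unfolding un by simp
    \<comment> \<open>The maximum cannot be the first letter of a block, because a larger letter
      follows it there.\<close>
    have notin: "?n \<notin> set as"
    proof
      assume "?n \<in> set as"
      then obtain i where i: "i < Suc r" "as ! i = ?n"
        using len' by (auto simp: in_set_conv_nth)
      moreover have "ds ! i \<in> set ds"
        using i len' by simp
      ultimately show False
        using asds[of i] le by (metis UnI2 linorder_not_less)
    qed
    moreover have "?n \<in> set as \<union> set ds"
      unfolding un by simp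
    ultimately have "?n \<in> set ds" by blast
    then obtain cs where cs: "ds = cs @ [?n]"
      using srt(2) le sorted_wrt_less_max_last by (metis UnI2)
    have "set as \<union> set cs = (set as \<union> set ds) - {?n}"
      using cs notin srt(2) by (auto simp: sorted_wrt_append)
    also have "\<dots> = {1..Suc r + r}"
      unfolding un by auto
    finally have "set as \<union> set cs = {1..Suc r + r}" .
    moreover have "as ! Suc i < cs ! i" if "i < r" for i
      using step[OF that] cs that len' by (simp add: nth_append)
    moreover have "sorted_wrt (<) cs"
      using srt(2) cs by (simp add: sorted_wrt_append)
    ultimately have "(as, cs) \<in> ?B"
      using len' srt cs by (simp add: ballot_def)
    moreover have "?g bs = (as, cs)"
      using cs by (simp add: as_def flip: ds_def)
    ultimately show ?thesis
      using bs_eq cs by simp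
  qed
  show "\<forall>bs\<in>?C. ?f (?g bs) = bs" "?g ` ?C \<subseteq> ?B"
    using chain by blast+
qed

text \<open>A chain on \<open>2 * k\<close> letters has \<open>k\<close> blocks, so all such chains
  have weight \<open>z ^ k\<close> and only their number is needed.\<close>

lemma sum_chains:
  fixes z :: "'a::field_char_0"
  defines "t \<equiv> \<lambda>m. \<Sum>bs\<in>block_perms link1324 {1..m}. z ^ length bs"
  shows "t 1 = z" and "odd m \<Longrightarrow> m \<noteq> 1 \<Longrightarrow> t m = 0" and "k \<noteq> 0 \<Longrightarrow> t (2 * k) = z ^ k * catalan (k - 1)"
proof -
  have "blocklists [1] = {[[1]]}"
    by (simp add: set_eq_iff blocklists_Cons)
  moreover have "block_perms link1324 {1..1} = {bs \<in> blocklists [1]. successively link1324 bs}"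
    by (auto simp: block_perms_def blocklists_def)
  ultimately have "block_perms link1324 {1..1} = {[[1]]}"
    by (simp only:) auto
  then show "t 1 = z"
    by (simp add: t_def)
next
  assume m: "odd m" "m \<noteq> 1"
  then have "2 \<le> m"
    by (cases m rule: nat.exhaust; cases "m - 1" rule: nat.exhaust) auto
  then have "block_perms link1324 {1..m} = {}"
    using block_perms_link1324(2)[of _ m] m by fastforce
  then show "t m = 0"
    by (simp add: t_def)
next
  assume "k \<noteq> 0"
  then obtain r where r: "k = Suc r"
    by (cases k) auto
  have "length bs = k" if "bs \<in> block_perms link1324 {1..2 * k}" for bs
    using block_perms_link1324(2)[OF that] r by simp
  then have "t (2 * k) = (\<Sum>bs\<in>block_perms link1324 {1..2 * k}. z ^ k)"
    unfolding t_def by (intro sum.cong) simp_all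
  also have "\<dots> = of_nat (card (ballot (Suc r) r)) * z ^ k"
    using bij_betw_same_card[OF bij_betw_ballot_block_perms[of r]] r by simp
  finally show "t (2 * k) = z ^ k * catalan (k - 1)"
    using r by (simp add: card_ballot_eq_catalan)
qed

lemma sum_odd_vanishing:
  fixes f :: "nat \<Rightarrow> 'a::comm_monoid_add"
  assumes "n \<noteq> 0" "\<And>m. odd m \<Longrightarrow> m \<noteq> 1 \<Longrightarrow> f m = 0"
  shows "(\<Sum>m=1..n. f m) = f 1 + (\<Sum>k=1..n div 2. f (2 * k))"
proof -
  have "(\<Sum>m=1..n. f m) = sum f (insert 1 ((*) 2 ` {1..n div 2}))"
  proof (rule sum.mono_neutral_right)
    show "\<forall>m\<in>{1..n} - insert 1 ((*) 2 ` {1..n div 2}). f m = 0"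
    proof (intro ballI assms(2) notI)
      fix m assume m: "m \<in> {1..n} - insert 1 ((*) 2 ` {1..n div 2})" and "even m"
      then obtain k where "m = 2 * k" by blast
      with m show False by auto
    qed auto
  qed (use assms(1) in auto)
  also have "\<dots> = f 1 + sum f ((*) 2 ` {1..n div 2})"
    by (subst sum.insert) auto
  also have "sum f ((*) 2 ` {1..n div 2}) = (\<Sum>k=1..n div 2. f (2 * k))"
    by (subst sum.reindex) (auto simp: inj_on_def)
  finally show ?thesis .
qed

text \<open>The clusters weighted by \<open>- y\<close> satisfy the recurrence of
  \<open>U_poly\<close>: the single-letter chain gives the term with \<open>n - 1\<close>, a chain
  of \<open>k\<close> blocks the one with \<open>n - 2 * k\<close>.\<close>

lemma poly_U_poly:
  fixes y :: "'a::field_char_0"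
  shows "poly (U_poly n) y = (\<Sum>w\<in>permutations_of_set {1..n}. block_sum link (- y) w)"
proof (induction n rule: less_induct)
  case (less n)
  define u where "u = (\<lambda>n. \<Sum>w\<in>permutations_of_set {1..n}. block_sum link (- y) w)"
  define t where "t = (\<lambda>m. \<Sum>bs\<in>block_perms link1324 {1..m}. (- y) ^ length bs)"
  have IH: "poly (U_poly m) y = u m" if "m < n" for m
    using less.IH[OF that] by (simp add: u_def)
  have u0: "u 0 = 1"
    by (simp add: u_def block_sum_def)
  have t: "t 1 = - y" "\<And>m. odd m \<Longrightarrow> m \<noteq> 1 \<Longrightarrow> t m = 0"
    "\<And>k. k \<noteq> 0 \<Longrightarrow> t (2 * k) = (- y) ^ k * catalan (k - 1)"
    unfolding t_def by (fact sum_chains)+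
  have rec: "u n = - y * u (n - 1) + (\<Sum>k=1..n div 2. (- y) ^ k * catalan (k - 1) * u (n - 2 * k))" if "n \<noteq> 0"
  proof -
    have "u n = (\<Sum>m=1..n. t m * u (n - m))"
      using sum_clusters_rec[OF that, of "- y"] by (simp add: u_def t_def)
    also have "\<dots> = t 1 * u (n - 1) + (\<Sum>k=1..n div 2. t (2 * k) * u (n - 2 * k))"
      using that t(2) by (intro sum_odd_vanishing) simp_all
    also have "(\<Sum>k=1..n div 2. t (2 * k) * u (n - 2 * k)) =
      (\<Sum>k=1..n div 2. (- y) ^ k * catalan (k - 1) * u (n - 2 * k))"
      using t(3) by (intro sum.cong) simp_all
    finally show ?thesis
      by (simp only: t(1))
  qed
  have "poly (U_poly n) y = u n"
  proof -
    consider "n = 0" | "n = 1" | "2 \<le> n" by linarith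
    then show ?thesis
    proof cases
      case 1
      then show ?thesis by (simp add: u0 U_poly.simps)
    next
      case 2
      then show ?thesis using rec by (simp add: u0 U_poly.simps)
    next
      case 3
      have cat0: "catalan 0 = (1::'a)"
        by (simp add: catalan_def)
      have "poly (U_poly n) y = - y * poly (U_poly (n - 1)) y - y * poly (U_poly (n - 2)) y
        + (\<Sum>k=2..n div 2. (- y) ^ k * catalan (k - 1) * poly (U_poly (n - 2 * k)) y)"
        using 3 by (subst U_poly.simps) (simp add: poly_sum poly_power algebra_simps)
      also have "\<dots> = - y * u (n - 1) - y * u (n - 2) + (\<Sum>k=2..n div 2. (- y) ^ k * catalan (k - 1) * u (n - 2 * k))"
        using 3 by (simp add: IH)
      \<comment> \<open>The separate term with \<open>n - 2\<close> is the summand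
        \<open>k = 1\<close>, because \<open>catalan 0 = 1\<close>.\<close>
      also have "\<dots> = - y * u (n - 1) + (\<Sum>k=1..n div 2. (- y) ^ k * catalan (k - 1) * u (n - 2 * k))"
      proof -
        have "1 \<le> n div 2" using 3 by linarith
        then show ?thesis
          by (subst sum.atLeast_Suc_atMost[of 1 "n div 2"]) (simp_all add: cat0 numeral_2_eq_2)
      qed
      also have "\<dots> = u n"
        using 3 by (intro rec[symmetric]) simp
      finally show ?thesis .
    qed
  qed
  then show ?case
    by (simp add: u_def)
qed

subsection \<open>Exponential generating functions\<close>

definition egf :: "(nat list \<Rightarrow> 'a) \<Rightarrow> 'a::field_char_0 fps" where
  "egf f = Abs_fps (\<lambda>n. (\<Sum>w\<in>permutations_of_set {1..n}. f w) / fact n)"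

lemma egf_nth: "egf f $ n = sum f (permutations_of_set {1..n}) / fact n"
  by (simp add: egf_def)

text \<open>The product sums over all ways to split a permutation into prefix and suffix.
  \<open>A\<close> is left arbitrary because it will be both \<open>{1..n}\<close> and
  \<open>{2..Suc n}\<close>.\<close>

lemma egf_mult_nth:
  fixes f g :: "nat list \<Rightarrow> 'a::field_char_0"
  assumes "order_invariant f" "order_invariant g" "finite A" "card A = n"
  shows "(egf f * egf g) $ n = (\<Sum>w\<in>permutations_of_set A. \<Sum>k\<le>n. f (take k w) * g (drop k w)) / fact n"
proof -
  have "(\<Sum>w\<in>permutations_of_set A. \<Sum>k\<le>n. f (take k w) * g (drop k w)) =
    (\<Sum>k\<le>n. of_nat (n choose k) * (sum f (permutations_of_set {1..k}) * sum g (permutations_of_set {1..n - k})))"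
    using assms by (subst sum.swap) (simp add: sum_permutations_of_set_take_drop)
  also have "\<dots> = (\<Sum>k\<le>n. fact n * (egf f $ k * egf g $ (n - k)))"
    by (intro sum.cong) (simp_all add: egf_nth binomial_fact)
  also have "\<dots> = fact n * (egf f * egf g) $ n"
    by (simp only: fps_mult_nth sum_distrib_left atMost_atLeast0)
  finally show ?thesis by simp
qed

section \<open>Weights of avoiding permutations and the cut at the minimum\<close>

definition nm_weight :: "'a \<Rightarrow> 'a \<Rightarrow> nat list \<Rightarrow> 'a::field_char_0" where
  "nm_weight x y w = (if w = [] then 1 else of_bool (avoids w) * (x ^ LRmin w * y ^ Suc (des w)))"

lemma order_invariant_nm_weight: "order_invariant (nm_weight x y)"
  by (simp add: order_invariant_def nm_weight_def avoids_map des_map LRmin_map)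

lemma NM_eq_egf: "NM Gamma_1324_123 x y = egf (nm_weight x y)"
proof (rule fps_ext)
  fix n
  show "NM Gamma_1324_123 x y $ n = egf (nm_weight x y) $ n"
  proof (cases "n = 0")
    case True
    then show ?thesis
      by (simp add: NM_def egf_def nm_weight_def)
  next
    case False
    have NM: "NM_set Gamma_1324_123 n = {w \<in> permutations_of_set {1..n}. avoids w}"
      unfolding NM_set_def using avoids_iff_no_match permutations_of_setD(2) by blast
    have "(\<Sum>w\<in>NM_set Gamma_1324_123 n. x ^ LRmin w * y ^ (1 + des w)) =
      (\<Sum>w\<in>permutations_of_set {1..n}. nm_weight x y w)"
      unfolding NM
    proof (rule sum.mono_neutral_cong_left)
      have ne: "w \<noteq> []" if "w \<in> permutations_of_set {1..n}" for w
        using that False by (auto simp: permutations_of_set_def)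
      then show "\<forall>w\<in>permutations_of_set {1..n} - {w \<in> permutations_of_set {1..n}. avoids w}. nm_weight x y w = 0"
        by (auto simp: nm_weight_def)
      show "x ^ LRmin w * y ^ (1 + des w) = nm_weight x y w"
        if "w \<in> {w \<in> permutations_of_set {1..n}. avoids w}" for w
        using that ne by (auto simp: nm_weight_def)
    qed auto
    then show ?thesis
      using False by (simp add: NM_def egf_def)
  qed
qed

text \<open>The factor \<open>x\<close> records \<open>m\<close> as a left-to-right minimum, so the
  second weight takes \<open>x = 1\<close>. For nonempty \<alpha> the descent into \<open>m\<close>
  makes the exponents \<open>Suc (des w)\<close> add up exactly; for empty \<alpha> the weight 1
  does.\<close>

lemma nm_weight_append_min:
  assumes "\<forall>a\<in>set \<alpha>. m < a" "\<forall>b\<in>set \<beta>. m < b"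
  shows "nm_weight x y (\<alpha> @ m # \<beta>) = x * (nm_weight x y \<alpha> * nm_weight 1 y (m # \<beta>))"
proof (cases "\<alpha> = []")
  case True
  have "LRmin (m # \<beta>) = 1"
    using LRmin_append_min[of "[]" m \<beta>] assms by (simp add: LRmin_def)
  then show ?thesis
    using True by (simp add: nm_weight_def)
next
  case False
  then show ?thesis
    using assms by (simp add: nm_weight_def avoids_append_min des_append_min LRmin_append_min power_add)
qed

text \<open>The shift makes room for a letter 0 below all others.\<close>

definition min_first_weight :: "'a \<Rightarrow> nat list \<Rightarrow> 'a::field_char_0" where
  "min_first_weight y w = nm_weight 1 y (0 # map Suc w)"

lemma min_first_weight:
  assumes "\<forall>b\<in>set \<beta>. m < b"
  shows "nm_weight 1 y (m # \<beta>) = min_first_weight y \<beta>"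
proof -
  \<comment> \<open>Sends the minimum \<open>m\<close> to 0 and shifts all other letters; it
    preserves the order since \<open>m\<close> is below all of \<beta>.\<close>
  define h where "h = (\<lambda>v. if v = m then 0 else Suc v)"
  have "strict_mono_on (set (m # \<beta>)) h"
    using assms by (auto simp: strict_mono_on_def h_def)
  then have "nm_weight 1 y (map h (m # \<beta>)) = nm_weight 1 y (m # \<beta>)"
    using order_invariant_nm_weight unfolding order_invariant_def by blast
  moreover have "map h (m # \<beta>) = 0 # map Suc \<beta>"
    using assms by (auto simp: h_def)
  ultimately show ?thesis
    unfolding min_first_weight_def by metis
qed

lemma order_invariant_min_first_weight: "order_invariant (min_first_weight y)"
  unfolding order_invariant_def
proof (intro allI impI)
  fix h :: "nat \<Rightarrow> nat" and w
  assume h: "strict_mono_on (set w) h"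
  \<comment> \<open>\<open>h\<close> carried over to the shifted alphabet, with the letter 0
    fixed.\<close>
  define h' where "h' = (\<lambda>v. case v of 0 \<Rightarrow> 0 | Suc v \<Rightarrow> Suc (h v))"
  have "strict_mono_on (set (0 # map Suc w)) h'"
    using h by (auto simp: strict_mono_on_def h'_def)
  then have "nm_weight 1 y (map h' (0 # map Suc w)) = nm_weight 1 y (0 # map Suc w)"
    using order_invariant_nm_weight unfolding order_invariant_def by blast
  moreover have "map h' (0 # map Suc w) = 0 # map Suc (map h w)"
    by (simp add: h'_def)
  ultimately show "min_first_weight y (map h w) = min_first_weight y w"
    unfolding min_first_weight_def by metis
qed

text \<open>Each permutation of the larger set arises once by inserting \<open>m\<close>; the
  inverse deletes \<open>m\<close> and counts the letters in front of it.\<close>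

lemma sum_permutations_insert_min:
  fixes f :: "nat list \<Rightarrow> 'a::comm_monoid_add"
  assumes "finite A" "m \<notin> A" "card A = n"
  shows "(\<Sum>w\<in>permutations_of_set (insert m A). f w) =
    (\<Sum>w\<in>permutations_of_set A. \<Sum>k\<le>n. f (take k w @ m # drop k w))"
proof -
  have len: "length w = n" if "w \<in> permutations_of_set A" for w
    using that assms length_finite_permutations_of_set by blast
  have "(\<Sum>w\<in>permutations_of_set A. \<Sum>k\<le>n. f (take k w @ m # drop k w)) =
    (\<Sum>(w, k)\<in>permutations_of_set A \<times> {..n}. f (take k w @ m # drop k w))"
    by (simp add: sum.cartesian_product)
  also have "\<dots> = (\<Sum>w\<in>permutations_of_set (insert m A). f w)"
  proof (rule sum.reindex_bij_witness[where j = "\<lambda>(w, k). take k w @ m # drop k w"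
        and i = "\<lambda>w. (remove1 m w, length (takeWhile (\<lambda>a. a \<noteq> m) w))"])
    fix s assume "s \<in> permutations_of_set A \<times> {..n}"
    then obtain w k where s: "s = (w, k)" and w: "w \<in> permutations_of_set A" and k: "k \<le> n" by auto
    have m: "m \<notin> set (take k w)" "m \<notin> set w"
      using w assms by (auto simp: permutations_of_set_def dest: in_set_takeD)
    have "takeWhile (\<lambda>a. a \<noteq> m) (take k w @ m # drop k w) = take k w"
      using m by (subst takeWhile_append2) auto
    then show "(\<lambda>w. (remove1 m w, length (takeWhile (\<lambda>a. a \<noteq> m) w))) (case s of (w, k) \<Rightarrow> take k w @ m # drop k w) = s"
      using s m k len[OF w] by (simp add: remove1_append)
    have "distinct (take k w @ drop k w)" "set (take k w @ drop k w) = A"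
      using w by (simp_all only: append_take_drop_id permutations_of_setD)
    then have "take k w @ m # drop k w \<in> permutations_of_set (insert m A)"
      using assms by (auto simp: permutations_of_set_def simp del: append_take_drop_id)
    then show "(case s of (w, k) \<Rightarrow> take k w @ m # drop k w) \<in> permutations_of_set (insert m A)"
      by (simp add: s)
  next
    fix w assume w: "w \<in> permutations_of_set (insert m A)"
    then have "m \<in> set w"
      by (auto simp: permutations_of_set_def)
    then obtain \<alpha> \<beta> where \<alpha>\<beta>: "w = \<alpha> @ m # \<beta>" "m \<notin> set \<alpha>"
      by (meson split_list_first)
    have "distinct (\<alpha> @ m # \<beta>)" "set (\<alpha> @ m # \<beta>) = insert m A"
      using w by (simp_all only: \<alpha>\<beta> permutations_of_setD)
    then have "distinct (\<alpha> @ \<beta>)" "set (\<alpha> @ \<beta>) = A"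
      using assms(2) by auto
    then have ab: "\<alpha> @ \<beta> \<in> permutations_of_set A" by blast
    have rem: "remove1 m w = \<alpha> @ \<beta>" "takeWhile (\<lambda>a. a \<noteq> m) w = \<alpha>"
      using \<alpha>\<beta> by (simp_all add: remove1_append takeWhile_append)
    show "(case (remove1 m w, length (takeWhile (\<lambda>a. a \<noteq> m) w)) of (w, k) \<Rightarrow> take k w @ m # drop k w) = w"
      unfolding rem by (simp add: \<alpha>\<beta>)
    show "(remove1 m w, length (takeWhile (\<lambda>a. a \<noteq> m) w)) \<in> permutations_of_set A \<times> {..n}"
      using ab len[OF ab] by (simp add: rem)
  qed auto
  finally show ?thesis by simp
qed

lemma fps_deriv_egf_nm_weight:
  "fps_deriv (egf (nm_weight x y)) = fps_const x * egf (nm_weight x y) * egf (min_first_weight y)"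
proof (rule fps_ext)
  fix n
  \<comment> \<open>The derivative looks at permutations of \<open>{1..Suc n}\<close>;
    \<open>A\<close> holds the letters left after deleting the entry 1.\<close>
  define A where "A = {2..Suc n}"
  have A: "finite A" "1 \<notin> A" "card A = n" "insert 1 A = {1..Suc n}"
    by (auto simp: A_def)
  have "(\<Sum>w\<in>permutations_of_set {1..Suc n}. nm_weight x y w) =
    (\<Sum>w\<in>permutations_of_set A. \<Sum>k\<le>n. nm_weight x y (take k w @ 1 # drop k w))"
    using sum_permutations_insert_min[OF A(1-3), of "nm_weight x y"] unfolding A(4) .
  also have "\<dots> = (\<Sum>w\<in>permutations_of_set A. \<Sum>k\<le>n.
      x * (nm_weight x y (take k w) * min_first_weight y (drop k w)))"
  proof (intro sum.cong refl)
    fix w k assume "w \<in> permutations_of_set A"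
    then have "\<forall>a\<in>set (take k w). 1 < a" "\<forall>a\<in>set (drop k w). 1 < a"
      by (auto simp: permutations_of_set_def A_def dest: in_set_takeD in_set_dropD)
    then show "nm_weight x y (take k w @ 1 # drop k w) =
        x * (nm_weight x y (take k w) * min_first_weight y (drop k w))"
      by (simp only: nm_weight_append_min min_first_weight)
  qed
  also have "\<dots> = x * (\<Sum>w\<in>permutations_of_set A. \<Sum>k\<le>n.
      nm_weight x y (take k w) * min_first_weight y (drop k w))"
    by (simp only: sum_distrib_left)
  also have "\<dots> = x * (fact n * (egf (nm_weight x y) * egf (min_first_weight y)) $ n)"
    using egf_mult_nth[OF order_invariant_nm_weight order_invariant_min_first_weight A(1,3), of x y y]
    by simp
  finally have *: "(\<Sum>w\<in>permutations_of_set {1..Suc n}. nm_weight x y w) =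
      x * (fact n * (egf (nm_weight x y) * egf (min_first_weight y)) $ n)" .
  have "fps_deriv (egf (nm_weight x y)) $ n =
    of_nat (Suc n) * ((\<Sum>w\<in>permutations_of_set {1..Suc n}. nm_weight x y w) / fact (Suc n))"
    by (simp add: egf_nth)
  also have "\<dots> = x * (egf (nm_weight x y) * egf (min_first_weight y)) $ n"
    unfolding * by (simp add: fact_Suc del: of_nat_Suc)
  finally show "fps_deriv (egf (nm_weight x y)) $ n =
      (fps_const x * egf (nm_weight x y) * egf (min_first_weight y)) $ n"
    by (simp add: mult.assoc)
qed

lemma U_fps_eq_egf: "U_fps y = egf (block_sum link (- y))"
  by (rule fps_ext) (simp add: U_fps_def egf_def poly_U_poly block_sum_def)

text \<open>The cancellation takes place within each permutation: by
  \<open>block_sum_convolution\<close> its prefix-suffix sum vanishes unless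
  \<open>n = 0\<close>.\<close>

lemma U_fps_mult_egf_nm_weight: "U_fps y * egf (nm_weight 1 y) = 1"
proof (rule fps_ext)
  fix n
  have "(\<Sum>k\<le>n. block_sum link (- y) (take k w) * nm_weight 1 y (drop k w)) = of_bool (n = 0)"
    if w: "w \<in> permutations_of_set {1..n}" for w
  proof -
    have len: "length w = n" and dist: "distinct w"
      using w length_finite_permutations_of_set[of w "{1..n}"] by (auto simp: permutations_of_setD)
    have "nm_weight 1 y (drop k w) = block_sum (\<lambda>p q. \<not> link p q) y (drop k w)" for k
      using dist by (simp add: nm_weight_def block_sum_not_link)
    then show ?thesis
      using block_sum_convolution[of w link y] len
      by (cases "n = 0") (auto simp: block_sum_def)
  qed
  then have "(\<Sum>w\<in>permutations_of_set {1..n}. \<Sum>k\<le>n. block_sum link (- y) (take k w) * nm_weight 1 y (drop k w)) =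
    (\<Sum>w\<in>permutations_of_set {1..n}. of_bool (n = 0))"
    by (rule sum.cong[OF refl])
  then have "(U_fps y * egf (nm_weight 1 y)) $ n = (\<Sum>w\<in>permutations_of_set {1..n}. of_bool (n = 0)) / fact n"
    using egf_mult_nth[OF order_invariant_block_sum_link order_invariant_nm_weight, of "{1..n}" n "- y" 1 y]
    by (simp only: U_fps_eq_egf) simp
  then show "(U_fps y * egf (nm_weight 1 y)) $ n = 1 $ n"
    by (cases "n = 0") auto
qed

theorem theorem1:
  fixes x y :: "'a::field_char_0"
  shows "NM Gamma_1324_123 x y = fps_scalar_power (1 / U_fps y) x"
proof -
  define V where "V = egf (nm_weight 1 y)"
  have "U_fps y $ 0 \<noteq> 0"
    by (simp add: U_fps_def)
  then have V: "1 / U_fps y = V"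
    using U_fps_mult_egf_nm_weight[of y] fps_inverse_unique[of "U_fps y" V]
    by (simp add: V_def fps_divide_unit)
  \<comment> \<open>The series \<open>egf (min_first_weight y)\<close> is free of \<open>x\<close>,
    so it serves in the differential equations of both \<open>V\<close> and
    \<open>egf (nm_weight x y)\<close>.\<close>
  have "egf (nm_weight x y) = fps_scalar_power V x"
  proof (rule eq_fps_scalar_powerI)
    show "fps_deriv V = V * egf (min_first_weight y)"
      using fps_deriv_egf_nm_weight[of 1 y] by (simp add: V_def)
    show "V $ 0 = 1" "egf (nm_weight x y) $ 0 = 1"
      by (simp_all add: V_def egf_nth nm_weight_def)
  qed (rule fps_deriv_egf_nm_weight)
  then show ?thesis
    by (simp add: NM_eq_egf V)
qed

end
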